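(* Let $S=\{a,b\}$, write $A=a^{-1}$ and $B=b^{-1}$, and let $$r=a\,a\,b\,A\,B\,a\,b\,A\,B\,B\,A\,b\,a\,a\,b\,A\,B\,B\,A\,b\in F(S)'\setminus\{e\}.$$ Then the simplicial volume of the one-relator group $G_r=\langle S\mid r\rangle$ satisfies $$\lVert G_r\rVert<2=4\left(\operatorname{scl}_S(r)-\frac12\right).$$ Thus the equality $\lVert G_w\rVert=4\left(\operatorname{scl}_S(w)-\frac12\right)$ does not hold for every non-trivial $w\in F(S)'$.
   Context: For a set $S$, $F(S)$ denotes the free group on $S$, $e$ its identity element, and $F(S)'=[F(S),F(S)]$ its commutator subgroup. For $w\in F(S)'$, the commutator length $\operatorname{cl}_S(w)$ is the least integer $n\ge 0$ such that $w$ is a product of $n$ commutators of elements of $F(S)$, and the stable commutator length is $\operatorname{scl}_S(w):=\lim_{n\to\infty}\operatorname{cl}_S(w^n)/n$. Capital letters denote inverses of the corresponding generators: $A=a^{-1}$, $B=b^{-1}$. For a non-trivial $w\in F(S)'$, put $G_w:=\langle S\mid w\rangle=F(S)/\langle\!\langle w\rangle\!\rangle$, where $\langle\!\langle w\rangle\!\rangle$ is the normal closure of $w$ in $F(S)$. By Hopf's formula, $H_2(G_w;\mathbb Z)\cong \langle\!\langle w\rangle\!\rangle/[F(S),\langle\!\langle w\rangle\!\rangle]$ is infinite cyclic, generated by the class of $w$; the fundamental class of $G_w$ is the image in $H_2(G_w;\mathbb R)$ of this generator (its sign is irrelevant below). The simplicial volume $\lVert G_w\rVert$ is the $\ell^1$-seminorm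 of the fundamental class, where the $\ell^1$-seminorm of $\alpha\in H_2(G;\mathbb R)$ is the infimum of $\sum_i|c_i|$ over all real cycles $\sum_i c_i\sigma_i$ representing $\alpha$ (finite sums with distinct $\sigma_i$), taken in the singular chain complex of a classifying space $K(G,1)$ or, equivalently, with respect to the standard basis of the (inhomogeneous) bar complex of $G$. *)

theory Defs
  imports Complex_Main "HOL-Algebra.Generated_Groups" "HOL-Library.Poly_Mapping"
begin

section \<open>Free groups\<close>

text \<open>
  A letter is a pair \<open>(s, e)\<close>: the generator \<open>s\<close> if \<open>e = True\<close>, its formal inverse if
  \<open>e = False\<close>. Elements of the free group are the reduced words.
\<close>

type_synonym 's letter = "'s \<times> bool"

abbreviation pos :: "'s \<Rightarrow> 's letter" where "pos s \<equiv> (s, True)"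
abbreviation neg :: "'s \<Rightarrow> 's letter" where "neg s \<equiv> (s, False)"

definition inv_letter :: "'s letter \<Rightarrow> 's letter"
  where "inv_letter x = (fst x, \<not> snd x)"

definition reduced :: "'s letter list \<Rightarrow> bool"
  where "reduced = successively (\<lambda>x y. y \<noteq> inv_letter x)"

definition cancel_Cons :: "'s letter \<Rightarrow> 's letter list \<Rightarrow> 's letter list"
  where "cancel_Cons x w =
    (case w of [] \<Rightarrow> [x] | y # ys \<Rightarrow> if y = inv_letter x then ys else x # w)"

text \<open>
  For a reduced word \<open>v\<close>, \<open>foldr cancel_Cons u v\<close> is the free reduction of \<open>u @ v\<close>.
\<close>

definition free_group :: "'s set \<Rightarrow> 's letter list monoid"
  where "free_group S =
    \<lparr>carrier = {w. reduced w \<and> fst ` set w \<subseteq> S},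
     mult = (\<lambda>u v. foldr cancel_Cons u v),
     one = []\<rparr>"

lemma inv_letter_inv_letter [simp]: "inv_letter (inv_letter x) = x"
  by (simp add: inv_letter_def)

lemma fst_inv_letter [simp]: "fst (inv_letter x) = fst x"
  by (simp add: inv_letter_def)

lemma inv_letter_neq [simp]: "inv_letter x \<noteq> x" "x \<noteq> inv_letter x"
  by (simp_all add: inv_letter_def prod_eq_iff)

lemma reduced_Nil [simp]: "reduced []"
  by (simp add: reduced_def)

lemma reduced_Cons: "reduced (x # w) \<longleftrightarrow> reduced w \<and> (w = [] \<or> hd w \<noteq> inv_letter x)"
  by (cases w) (auto simp: reduced_def)

lemma reduced_cancel_Cons: "reduced w \<Longrightarrow> reduced (cancel_Cons x w)"
  by (auto simp: cancel_Cons_def reduced_Cons split: list.splits)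

lemma reduced_foldr: "reduced v \<Longrightarrow> reduced (foldr cancel_Cons u v)"
  by (induction u) (auto simp: reduced_cancel_Cons)

lemma set_cancel_Cons: "set (cancel_Cons x w) \<subseteq> insert x (set w)"
  by (auto simp: cancel_Cons_def split: list.splits if_splits)

lemma set_foldr: "set (foldr cancel_Cons u v) \<subseteq> set u \<union> set v"
proof (induction u)
  case (Cons x u)
  then show ?case using set_cancel_Cons[of x "foldr cancel_Cons u v"] by auto
qed simp

lemma cancel_Cons_cancel:
  "reduced w \<Longrightarrow> cancel_Cons x (cancel_Cons (inv_letter x) w) = w"
  by (cases w; cases "tl w") (auto simp: cancel_Cons_def reduced_Cons)

lemma foldr_cancel_Cons:
  assumes "reduced w"
  shows "foldr cancel_Cons (cancel_Cons x v) w = cancel_Cons x (foldr cancel_Cons v w)"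
proof (cases "v \<noteq> [] \<and> hd v = inv_letter x")
  case True
  then obtain ys where "v = inv_letter x # ys" by (cases v) auto
  then show ?thesis
    by (simp add: cancel_Cons_cancel reduced_foldr assms) (simp add: cancel_Cons_def)
next
  case False
  then have "cancel_Cons x v = x # v" by (auto simp: cancel_Cons_def split: list.splits)
  then show ?thesis by simp
qed

lemma foldr_assoc:
  "reduced w \<Longrightarrow>
    foldr cancel_Cons (foldr cancel_Cons u v) w = foldr cancel_Cons u (foldr cancel_Cons v w)"
  by (induction u) (simp_all add: foldr_cancel_Cons)

lemma foldr_reduced_Nil: "reduced u \<Longrightarrow> foldr cancel_Cons u [] = u"
proof (induction u)
  case (Cons x u)
  then show ?case by (auto simp: reduced_Cons cancel_Cons_def split: list.splits)
qed simp

lemma foldr_inverse: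
  assumes "reduced v"
  shows "foldr cancel_Cons (map inv_letter (rev u)) (foldr cancel_Cons u v) = v"
proof (induction u)
  case (Cons x u)
  have "cancel_Cons (inv_letter x) (cancel_Cons x (foldr cancel_Cons u v)) = foldr cancel_Cons u v"
    using cancel_Cons_cancel[of "foldr cancel_Cons u v" "inv_letter x"] reduced_foldr[OF assms]
    by simp
  then show ?case using Cons by simp
qed (simp add: assms)

lemma group_free_group: "group (free_group S)"
proof (rule groupI)
  fix u assume u: "u \<in> carrier (free_group S)"
  let ?v = "foldr cancel_Cons (map inv_letter (rev u)) []"
  have "?v \<in> carrier (free_group S)"
    using u set_foldr[of "map inv_letter (rev u)" "[]"]
    by (force simp: free_group_def reduced_foldr)
  moreover have "?v \<otimes>\<^bsub>free_group S\<^esub> u = \<one>\<^bsub>free_group S\<^esub>"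
    using u foldr_inverse[of "[]" u] by (auto simp: free_group_def foldr_assoc foldr_reduced_Nil)
  ultimately show "\<exists>y\<in>carrier (free_group S). y \<otimes>\<^bsub>free_group S\<^esub> u = \<one>\<^bsub>free_group S\<^esub>"
    by blast
next
  fix u v assume "u \<in> carrier (free_group S)" "v \<in> carrier (free_group S)"
  then show "u \<otimes>\<^bsub>free_group S\<^esub> v \<in> carrier (free_group S)"
    using set_foldr[of u v] by (force simp: free_group_def reduced_foldr)
qed (auto simp: free_group_def foldr_assoc)

lemma inv_free_group_pos:
  assumes "s \<in> S"
  shows "inv\<^bsub>free_group S\<^esub> [pos s] = [neg s]"
  by (rule group.inv_equality[OF group_free_group])
    (use assms in \<open>auto simp: free_group_def reduced_Cons cancel_Cons_def inv_letter_def\<close>)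


section \<open>Stable commutator length\<close>

text \<open>\<open>derived_set G (carrier G)\<close> is the set of commutators of elements of \<open>G\<close>.\<close>

definition is_commutator_product :: "('g, 'm) monoid_scheme \<Rightarrow> nat \<Rightarrow> 'g \<Rightarrow> bool"
  where "is_commutator_product G n w \<longleftrightarrow>
    (\<exists>cs. length cs = n \<and> set cs \<subseteq> derived_set G (carrier G) \<and>
      w = foldr (\<lambda>x y. x \<otimes>\<^bsub>G\<^esub> y) cs \<one>\<^bsub>G\<^esub>)"

definition cl :: "('g, 'm) monoid_scheme \<Rightarrow> 'g \<Rightarrow> nat"
  where "cl G w = (LEAST n. is_commutator_product G n w)"

text \<open>
  \<open>cl\<close> and \<open>scl\<close> are meaningful for \<open>w\<close> in the commutator subgroup; there the limit exists
  because \<open>n \<mapsto> cl (w\<^sup>n)\<close> is subadditive.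
\<close>

definition scl :: "('g, 'm) monoid_scheme \<Rightarrow> 'g \<Rightarrow> real"
  where "scl G w = lim (\<lambda>n::nat. real (cl G (w [^]\<^bsub>G\<^esub> n)) / real n)"


section \<open>One-relator groups\<close>

definition normal_closure :: "('g, 'm) monoid_scheme \<Rightarrow> 'g set \<Rightarrow> 'g set"
  where "normal_closure G A = \<Inter> {N. N \<lhd> G \<and> A \<subseteq> N}"

definition one_relator_group :: "'s set \<Rightarrow> 's letter list \<Rightarrow> 's letter list set monoid"
  where "one_relator_group S w = free_group S Mod normal_closure (free_group S) {w}"

lemma (in group) normal_closure_normal:
  assumes "A \<subseteq> carrier G"
  shows "normal_closure G A \<lhd> G"
proof -
  let ?F = "{N. N \<lhd> G \<and> A \<subseteq> N}"
  have ne: "?F \<noteq> {}" using assms normal_self by blast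
  have "subgroup (\<Inter> ?F) G"
    by (rule subgroups_Inter) (use ne in \<open>auto dest: normal_imp_subgroup\<close>)
  moreover have "x \<otimes> h \<otimes> inv x \<in> \<Inter> ?F" if "x \<in> carrier G" "h \<in> \<Inter> ?F" for x h
    using that by (auto intro: normal.inv_op_closed2)
  ultimately show ?thesis unfolding normal_closure_def normal_inv_iff by blast
qed

lemma group_one_relator_group:
  "w \<in> carrier (free_group S) \<Longrightarrow> group (one_relator_group S w)"
  unfolding one_relator_group_def
  by (intro normal.factorgroup_is_group group.normal_closure_normal group_free_group) simp


section \<open>Group homology via the bar complex\<close>

text \<open>
  Inhomogeneous bar complex: the basis element \<open>[g\<^sub>1 | \<dots> | g\<^sub>n]\<close> is the list of the \<open>g\<^sub>i\<close>.
  The coefficients are in the (trivial) module of type \<open>'k\<close>.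
\<close>

definition bar_chains :: "('g, 'm) monoid_scheme \<Rightarrow> nat \<Rightarrow> ('g list \<Rightarrow>\<^sub>0 'k::comm_ring_1) set"
  where "bar_chains G n =
    {c. \<forall>xs\<in>Poly_Mapping.keys c. length xs = n \<and> set xs \<subseteq> carrier G}"

definition bar_face :: "('g, 'm) monoid_scheme \<Rightarrow> nat \<Rightarrow> 'g list \<Rightarrow> 'g list"
  where "bar_face G i xs =
    (if i = 0 then tl xs
     else if i = length xs then butlast xs
     else take (i - 1) xs @ [xs ! (i - 1) \<otimes>\<^bsub>G\<^esub> xs ! i] @ drop (i + 1) xs)"

definition bar_boundary ::
    "('g, 'm) monoid_scheme \<Rightarrow> nat \<Rightarrow> ('g list \<Rightarrow>\<^sub>0 'k::comm_ring_1) \<Rightarrow> ('g list \<Rightarrow>\<^sub>0 'k)"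
  where "bar_boundary G n c =
    (if n = 0 then 0
     else \<Sum>xs\<in>Poly_Mapping.keys c. \<Sum>i\<le>n.
       Poly_Mapping.single (bar_face G i xs) ((- 1) ^ i * Poly_Mapping.lookup c xs))"

definition bar_cycle_group ::
    "('g, 'm) monoid_scheme \<Rightarrow> nat \<Rightarrow> ('g list \<Rightarrow>\<^sub>0 'k::comm_ring_1) monoid"
  where "bar_cycle_group G n =
    \<lparr>carrier = {c \<in> bar_chains G n. bar_boundary G n c = 0}, mult = (+), one = 0\<rparr>"

definition bar_boundaries ::
    "('g, 'm) monoid_scheme \<Rightarrow> nat \<Rightarrow> ('g list \<Rightarrow>\<^sub>0 'k::comm_ring_1) set"
  where "bar_boundaries G n = bar_boundary G (Suc n) ` bar_chains G (Suc n)"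

text \<open>Homology classes are cosets, that is, sets of homologous cycles.\<close>

definition bar_homology ::
    "('g, 'm) monoid_scheme \<Rightarrow> nat \<Rightarrow> ('g list \<Rightarrow>\<^sub>0 'k::comm_ring_1) set monoid"
  where "bar_homology G n = bar_cycle_group G n Mod bar_boundaries G n"

text \<open>
  The image of an integral class in real homology; the union is over all integral
  representatives, which give the same coset.
\<close>

definition real_class ::
    "('g, 'm) monoid_scheme \<Rightarrow> nat \<Rightarrow> ('g list \<Rightarrow>\<^sub>0 int) set \<Rightarrow> ('g list \<Rightarrow>\<^sub>0 real) set"
  where "real_class G n \<alpha> =
    (\<Union>c\<in>\<alpha>. bar_boundaries G n #>\<^bsub>bar_cycle_group G n\<^esub> Poly_Mapping.map real_of_int c)"

definition l1_norm :: "('x \<Rightarrow>\<^sub>0 real) \<Rightarrow> real"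
  where "l1_norm c = (\<Sum>x\<in>Poly_Mapping.keys c. \<bar>Poly_Mapping.lookup c x\<bar>)"

definition l1_seminorm :: "('x \<Rightarrow>\<^sub>0 real) set \<Rightarrow> real"
  where "l1_seminorm \<alpha> = (INF c\<in>\<alpha>. l1_norm c)"


section \<open>Simplicial volume of one-relator groups\<close>

text \<open>
  By Hopf's formula, for non-trivial \<open>w\<close> in the commutator subgroup of the free group \<open>F\<close>,
  the group \<open>H\<^sub>2(G\<^sub>w; \<int>) \<cong> \<langle>\<langle>w\<rangle>\<rangle> / [F, \<langle>\<langle>w\<rangle>\<rangle>]\<close> is infinite cyclic, generated by the class
  of \<open>w\<close>. Its only generators are this class and its negative, and the two have the same
  \<open>\<ell>\<^sup>1\<close>-seminorm, so the choice in \<open>simplicial_volume\<close> is immaterial.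
\<close>

definition fundamental_class ::
    "'s set \<Rightarrow> 's letter list \<Rightarrow> ('s letter list set list \<Rightarrow>\<^sub>0 real) set \<Rightarrow> bool"
  where "fundamental_class S w \<alpha> \<longleftrightarrow>
    (let G = one_relator_group S w;
         H = (bar_homology G 2 :: ('s letter list set list \<Rightarrow>\<^sub>0 int) set monoid)
     in \<exists>z\<in>carrier H. generate H {z} = carrier H \<and> \<alpha> = real_class G 2 z)"

definition simplicial_volume :: "'s set \<Rightarrow> 's letter list \<Rightarrow> real"
  where "simplicial_volume S w = l1_seminorm (SOME \<alpha>. fundamental_class S w \<alpha>)"

end

theory Submission
  imports Defs
begin

text \<open>
  With \<open>y = [a, b]\<close> and \<open>x = [B, A]\<close> the relator is conjugate to \<open>y y x y x\<close>, and \<open>p = a b\<close> conjugates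
  \<open>y\<close> into \<open>x\<^sup>-\<^sup>1\<close>. In \<open>G\<^sub>r\<close> the element \<open>t = y x\<close> satisfies \<open>y = t\<^sup>-\<^sup>2\<close> and \<open>x = t\<^sup>3\<close>, which yields the
  Baumslag-Solitar relation \<open>t\<^sup>2 p = p t\<^sup>3\<close> and then that \<open>p\<close> commutes with \<open>g = a t\<^sup>6\<close>. The same
  computation in \<open>F / [F, N]\<close>, where \<open>N\<close> is the normal closure of \<open>r\<close>, gives \<open>[g, p] = r\<close>, so the torus
  \<open>[p | g] - [g | p]\<close> generates \<open>H\<^sub>2(G\<^sub>r; \<int>)\<close>. Replacing \<open>p\<close> by \<open>p\<^sup>n\<close> multiplies its class by \<open>n\<close>
  without changing the norm of the cycle, hence the simplicial volume of \<open>G\<^sub>r\<close> is small (indeed zero).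
  On the other hand \<open>scl r = 1\<close>: the lower bound comes from a counting quasimorphism of defect 1
  that takes the value \<open>4 n\<close> on \<open>r\<^sup>n\<close>, the upper bound from writing the product of \<open>r\<close> and one of its
  conjugates as a product of two commutators.
\<close>

section \<open>Products of commutators\<close>

context group
begin

lemma inv_mult_cancel_left [simp]:
  "x \<in> carrier G \<Longrightarrow> y \<in> carrier G \<Longrightarrow> inv x \<otimes> (x \<otimes> y) = y"
  by (simp flip: m_assoc)

lemma mult_inv_cancel_left [simp]:
  "x \<in> carrier G \<Longrightarrow> y \<in> carrier G \<Longrightarrow> x \<otimes> (inv x \<otimes> y) = y"
  by (simp flip: m_assoc)

lemma derived_setI:
  "x \<in> carrier G \<Longrightarrow> y \<in> carrier G \<Longrightarrow> x \<otimes> y \<otimes> inv x \<otimes> inv y \<in> derived_set G (carrier G)"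
  by blast

lemma derived_set_carrier: "derived_set G (carrier G) \<subseteq> carrier G"
  by auto

lemma foldr_mult_closed:
  "set cs \<subseteq> carrier G \<Longrightarrow> foldr (\<lambda>x y. x \<otimes> y) cs \<one> \<in> carrier G"
  by (induction cs) auto

lemma foldr_mult_append:
  "set cs \<subseteq> carrier G \<Longrightarrow> set ds \<subseteq> carrier G \<Longrightarrow>
    foldr (\<lambda>x y. x \<otimes> y) (cs @ ds) \<one> = foldr (\<lambda>x y. x \<otimes> y) cs \<one> \<otimes> foldr (\<lambda>x y. x \<otimes> y) ds \<one>"
  by (induction cs) (auto simp: m_assoc foldr_mult_closed)

lemma is_commutator_product_closed: "is_commutator_product G n w \<Longrightarrow> w \<in> carrier G"
  using derived_set_carrier by (force simp: is_commutator_product_def intro!: foldr_mult_closed)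

lemma is_commutator_product_mult:
  assumes "is_commutator_product G m u" "is_commutator_product G n v"
  shows "is_commutator_product G (m + n) (u \<otimes> v)"
proof -
  obtain cs ds where
    "length cs = m" "set cs \<subseteq> derived_set G (carrier G)" "u = foldr (\<lambda>x y. x \<otimes> y) cs \<one>"
    "length ds = n" "set ds \<subseteq> derived_set G (carrier G)" "v = foldr (\<lambda>x y. x \<otimes> y) ds \<one>"
    using assms unfolding is_commutator_product_def by blast
  moreover have "set cs \<subseteq> carrier G" "set ds \<subseteq> carrier G"
    using calculation derived_set_carrier by blast+
  ultimately show ?thesis
    unfolding is_commutator_product_def
    by (intro exI[of _ "cs @ ds"]) (simp add: foldr_mult_append del: foldr_append)
qed

lemma is_commutator_product_0: "is_commutator_product G 0 \<one>"
  by (simp add: is_commutator_product_def)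

lemma is_commutator_product_commutator:
  assumes "x \<in> carrier G" "y \<in> carrier G"
  shows "is_commutator_product G 1 (x \<otimes> y \<otimes> inv x \<otimes> inv y)"
  unfolding is_commutator_product_def using assms derived_setI[OF assms]
  by (intro exI[of _ "[x \<otimes> y \<otimes> inv x \<otimes> inv y]"]) simp

text \<open>Short products are padded with the commutator of \<open>\<one>\<close> with
  itself.\<close>

lemma is_commutator_product_mono:
  assumes "is_commutator_product G m w" "m \<le> n"
  shows "is_commutator_product G n w"
  using assms(2,1)
proof (induction rule: dec_induct)
  case (step n)
  then show ?case
    using is_commutator_product_mult[OF step.IH is_commutator_product_commutator[OF one_closed one_closed]]
    by (simp add: is_commutator_product_closed)
qed

lemma is_commutator_product_cases:
  assumes "is_commutator_product G n w"
  shows "n = 0 \<and> w = \<one> \<or>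
    (\<exists>k x y v. n = Suc k \<and> x \<in> carrier G \<and> y \<in> carrier G \<and> is_commutator_product G k v \<and>
      w = (x \<otimes> y \<otimes> inv x \<otimes> inv y) \<otimes> v)"
proof -
  obtain cs where cs: "length cs = n" "set cs \<subseteq> derived_set G (carrier G)"
    "w = foldr (\<lambda>x y. x \<otimes> y) cs \<one>"
    using assms unfolding is_commutator_product_def by blast
  show ?thesis
  proof (cases cs)
    case (Cons c ds)
    then have "is_commutator_product G (length ds) (foldr (\<lambda>x y. x \<otimes> y) ds \<one>)"
      using cs unfolding is_commutator_product_def by auto
    with Cons cs show ?thesis by auto
  qed (use cs in simp)
qed

lemma is_commutator_product_conj:
  assumes "is_commutator_product G n w" "g \<in> carrier G"
  shows "is_commutator_product G n (g \<otimes> w \<otimes> inv g)"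
  using assms(1)
proof (induction n arbitrary: w)
  case 0
  then show ?case using assms(2) is_commutator_product_cases[OF 0] is_commutator_product_0 by auto
next
  case (Suc n)
  then obtain x y v where *: "x \<in> carrier G" "y \<in> carrier G" "is_commutator_product G n v"
      "w = (x \<otimes> y \<otimes> inv x \<otimes> inv y) \<otimes> v"
    using is_commutator_product_cases[OF Suc.prems] by blast
  have v: "v \<in> carrier G" by (rule is_commutator_product_closed[OF *(3)])
  let ?x = "g \<otimes> x \<otimes> inv g" and ?y = "g \<otimes> y \<otimes> inv g"
  have "is_commutator_product G (1 + n) ((?x \<otimes> ?y \<otimes> inv ?x \<otimes> inv ?y) \<otimes> (g \<otimes> v \<otimes> inv g))"
    using * assms(2) by (intro is_commutator_product_mult is_commutator_product_commutator Suc.IH) auto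
  moreover have "(?x \<otimes> ?y \<otimes> inv ?x \<otimes> inv ?y) \<otimes> (g \<otimes> v \<otimes> inv g) = g \<otimes> w \<otimes> inv g"
    using * assms(2) v by (simp add: m_assoc inv_mult_group)
  ultimately show ?case by simp
qed

lemma is_commutator_product_inv:
  assumes "is_commutator_product G n w"
  shows "is_commutator_product G n (inv w)"
  using assms
proof (induction n arbitrary: w)
  case 0
  then show ?case using is_commutator_product_cases[OF 0] is_commutator_product_0 by auto
next
  case (Suc n)
  then obtain x y v where *: "x \<in> carrier G" "y \<in> carrier G" "is_commutator_product G n v"
      "w = (x \<otimes> y \<otimes> inv x \<otimes> inv y) \<otimes> v"
    using is_commutator_product_cases[OF Suc.prems] by blast
  have v: "v \<in> carrier G" by (rule is_commutator_product_closed[OF *(3)])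
  have "is_commutator_product G (n + 1) (inv v \<otimes> (y \<otimes> x \<otimes> inv y \<otimes> inv x))"
    using * by (intro is_commutator_product_mult is_commutator_product_commutator Suc.IH)
  moreover have "inv v \<otimes> (y \<otimes> x \<otimes> inv y \<otimes> inv x) = inv w"
    using * v by (simp add: m_assoc inv_mult_group)
  ultimately show ?case by simp
qed

lemma is_commutator_product_pow:
  assumes "is_commutator_product G m w"
  shows "is_commutator_product G (n * m) (w [^] (n::nat))"
proof (induction n)
  case (Suc n)
  then show ?case using is_commutator_product_mult[OF Suc assms] by (simp add: add.commute)
qed (simp add: is_commutator_product_0)

text \<open>
  In the induction step, \<open>x\<^sup>n y\<^sup>n (x y)\<^sup>2 = x\<^sup>n [y\<^sup>n x y, x y\<^sup>-\<^sup>n] x\<^sup>2 y\<^sup>n\<^sup>+\<^sup>2\<close>: two further factors \<open>x y\<close>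
  cost only one commutator.
\<close>

lemma pow_double_mult:
  assumes x: "x \<in> carrier G" and y: "y \<in> carrier G"
  shows "\<exists>c. is_commutator_product G k c \<and>
    (x \<otimes> y) [^] (2 * k) = c \<otimes> (x [^] (2 * k) \<otimes> y [^] (2 * k))"
proof (induction k)
  case 0
  then show ?case by (intro exI[of _ \<one>]) (simp add: is_commutator_product_0)
next
  case (Suc k)
  then obtain c where c: "is_commutator_product G k c"
      "(x \<otimes> y) [^] (2 * k) = c \<otimes> (x [^] (2 * k) \<otimes> y [^] (2 * k))"
    by blast
  let ?u = "x [^] (2 * k)" and ?v = "y [^] (2 * k)"
  have cc: "c \<in> carrier G" "?u \<in> carrier G" "?v \<in> carrier G"
    using is_commutator_product_closed[OF c(1)] assms by auto
  define s where "s = ?v \<otimes> (x \<otimes> y)"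
  define t where "t = x \<otimes> inv ?v"
  have st: "s \<in> carrier G" "t \<in> carrier G" using assms cc by (auto simp: s_def t_def)
  define d where "d = ?u \<otimes> (s \<otimes> t \<otimes> inv s \<otimes> inv t) \<otimes> inv ?u"
  have d: "is_commutator_product G 1 d"
    unfolding d_def using st cc by (intro is_commutator_product_conj is_commutator_product_commutator)
  have dc: "d \<in> carrier G" using is_commutator_product_closed[OF d] .
  have comm: "y \<otimes> ?v = ?v \<otimes> y" using y by (metis nat_pow_comm nat_pow_Suc2 nat_pow_Suc)
  have 1: "x [^] (2 * Suc k) = ?u \<otimes> (x \<otimes> x)" "y [^] (2 * Suc k) = y \<otimes> (?v \<otimes> y)"
    using assms cc comm by (simp_all add: m_assoc flip: m_assoc[of y ?v y])
  have "(x \<otimes> y) [^] (2 * Suc k) = c \<otimes> (?u \<otimes> ?v) \<otimes> ((x \<otimes> y) \<otimes> (x \<otimes> y))"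
    using assms cc c(2) by (simp add: m_assoc)
  also have "\<dots> = (c \<otimes> d) \<otimes> (x [^] (2 * Suc k) \<otimes> y [^] (2 * Suc k))"
    unfolding 1 d_def s_def t_def using assms cc
    by (simp add: m_assoc inv_mult_group)
  finally show ?case
    using is_commutator_product_mult[OF c(1) d] by (intro exI[of _ "c \<otimes> d"]) simp
qed

text \<open>The commutator of \<open>x\<close> and \<open>y\<close> is the product of
  \<open>x\<close> and \<open>y x^-1 y^-1\<close>. Once \<open>pow_double_mult\<close> has split the
  power at the cost of \<open>k\<close> commutators, the two remaining powers recombine into the
  single commutator of \<open>x^(2k)\<close> and \<open>y\<close>.\<close>

lemma pow_double_commutator:
  assumes x: "x \<in> carrier G" and y: "y \<in> carrier G"
  shows "is_commutator_product G (k + 1) ((x \<otimes> y \<otimes> inv x \<otimes> inv y) [^] (2 * k))"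
proof -
  let ?z = "y \<otimes> inv x \<otimes> inv y"
  obtain c where c: "is_commutator_product G k c"
    "(x \<otimes> ?z) [^] (2 * k) = c \<otimes> (x [^] (2 * k) \<otimes> ?z [^] (2 * k))"
    using pow_double_mult[of x ?z k] assms by auto
  have conj: "(y \<otimes> u \<otimes> inv y) [^] n = y \<otimes> u [^] n \<otimes> inv y" if "u \<in> carrier G" for u and n :: nat
    using that y by (induction n) (simp_all add: m_assoc)
  have "?z [^] (2 * k) = y \<otimes> inv (x [^] (2 * k)) \<otimes> inv y"
    using assms by (simp add: conj nat_pow_inv)
  then have "(x \<otimes> y \<otimes> inv x \<otimes> inv y) [^] (2 * k) =
      c \<otimes> (x [^] (2 * k) \<otimes> y \<otimes> inv (x [^] (2 * k)) \<otimes> inv y)"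
    using c assms by (simp add: m_assoc)
  then show ?thesis
    using is_commutator_product_mult[OF c(1) is_commutator_product_commutator[of "x [^] (2 * k)" y]] assms
    by simp
qed

text \<open>The power \<open>(r (h r h^-1))^(2k)\<close> is read in two ways. As a power of a
  product of two commutators it costs \<open>3 k + 2\<close>. Splitting it into a power of
  \<open>r\<close> and one of its conjugate costs \<open>k\<close>, and undoing the conjugation
  costs one more. Asymptotically this is one commutator per factor \<open>r\<close>.\<close>

lemma pow_4_commutator_product:
  assumes r: "r \<in> carrier G" and h: "h \<in> carrier G"
    and x: "x \<in> carrier G" and y: "y \<in> carrier G" and u: "u \<in> carrier G" and v: "v \<in> carrier G"
    and eq: "r \<otimes> (h \<otimes> r \<otimes> inv h) = (x \<otimes> y \<otimes> inv x \<otimes> inv y) \<otimes> (u \<otimes> v \<otimes> inv u \<otimes> inv v)"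
  shows "is_commutator_product G (4 * k + 3) (r [^] (4 * k))"
proof -
  let ?c = "x \<otimes> y \<otimes> inv x \<otimes> inv y" and ?d = "u \<otimes> v \<otimes> inv u \<otimes> inv v"
  let ?R = "r [^] (2 * k)"
  obtain e where e: "is_commutator_product G k e"
      "(r \<otimes> (h \<otimes> r \<otimes> inv h)) [^] (2 * k) = e \<otimes> (?R \<otimes> (h \<otimes> r \<otimes> inv h) [^] (2 * k))"
    using pow_double_mult[of r "h \<otimes> r \<otimes> inv h" k] r h by auto
  obtain f where f: "is_commutator_product G k f"
      "(?c \<otimes> ?d) [^] (2 * k) = f \<otimes> (?c [^] (2 * k) \<otimes> ?d [^] (2 * k))"
    using pow_double_mult[of ?c ?d k] x y u v by auto
  have conj: "(h \<otimes> r \<otimes> inv h) [^] n = h \<otimes> r [^] n \<otimes> inv h" for n :: nat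
    using r h by (induction n) (simp_all add: m_assoc)
  have ef: "e \<in> carrier G" "f \<in> carrier G"
    using e(1) f(1) by (auto dest: is_commutator_product_closed)
  have P: "is_commutator_product G (k + (k + 1 + (k + 1))) ((?c \<otimes> ?d) [^] (2 * k))"
    unfolding f(2) using f(1) x y u v
    by (intro is_commutator_product_mult pow_double_commutator)
  \<comment> \<open>The conjugated commutator of \<open>?R\<close> and \<open>h\<close> that turns
    \<open>?R (h ?R h^-1)\<close> into \<open>?R ?R\<close>.\<close>
  define q where "q = ?R \<otimes> (?R \<otimes> h \<otimes> inv ?R \<otimes> inv h) \<otimes> inv ?R"
  have q: "is_commutator_product G 1 q"
    unfolding q_def using r h by (intro is_commutator_product_conj is_commutator_product_commutator) auto
  have "q \<otimes> inv e \<otimes> (?c \<otimes> ?d) [^] (2 * k) = q \<otimes> (?R \<otimes> (h \<otimes> ?R \<otimes> inv h))"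
    unfolding eq[symmetric] e(2) conj using r h ef is_commutator_product_closed[OF q]
    by (simp add: m_assoc)
  also have "\<dots> = ?R \<otimes> ?R" using r h by (simp add: q_def m_assoc inv_mult_group)
  also have "\<dots> = r [^] (4 * k)" using r by (simp add: nat_pow_mult)
  finally have "r [^] (4 * k) = q \<otimes> inv e \<otimes> (?c \<otimes> ?d) [^] (2 * k)" by simp
  moreover have "is_commutator_product G (1 + k + (k + (k + 1 + (k + 1))))
      (q \<otimes> inv e \<otimes> (?c \<otimes> ?d) [^] (2 * k))"
    by (intro is_commutator_product_mult q is_commutator_product_inv e(1) P)
  ultimately show ?thesis by (simp add: algebra_simps numeral_eq_Suc)
qed

end

section \<open>A turning quasimorphism on the free group\<close>

abbreviation inv_word :: "'s letter list \<Rightarrow> 's letter list"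
  where "inv_word w \<equiv> map inv_letter (rev w)"

lemma reduced_inv_word: "reduced w \<Longrightarrow> reduced (inv_word w)"
proof -
  assume "reduced w"
  moreover have "x \<noteq> inv_letter y \<longleftrightarrow> inv_letter x \<noteq> y" for x y :: "'s letter"
    by (metis inv_letter_inv_letter)
  ultimately show ?thesis
    unfolding reduced_def successively_map successively_rev
    by (auto elim!: successively_mono)
qed

lemma inv_free_group:
  assumes "w \<in> carrier (free_group S)"
  shows "inv\<^bsub>free_group S\<^esub> w = inv_word w"
proof (rule group.inv_equality[OF group_free_group])
  show "inv_word w \<in> carrier (free_group S)"
    using assms reduced_inv_word[of w] by (force simp: free_group_def)
  show "inv_word w \<otimes>\<^bsub>free_group S\<^esub> w = \<one>\<^bsub>free_group S\<^esub>"
    using assms foldr_inverse[of "[]" w] by (simp add: free_group_def foldr_reduced_Nil)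
qed (rule assms)

text \<open>As \<open>u\<close> is reduced, a letter put in front of a non-empty surviving part
  \<open>p\<close> cannot cancel, so a suffix of \<open>u\<close> cancels against a prefix of
  \<open>v\<close>. The words \<open>p\<close>, \<open>q\<close>, \<open>s\<close> are the legs of
  the tripod spanned by the two factors.\<close>

lemma foldr_cancel_Cons_decomp:
  assumes "reduced u"
  shows "\<exists>p q s. u = p @ q \<and> v = inv_word q @ s \<and> foldr cancel_Cons u v = p @ s"
  using assms
proof (induction u)
  case Nil
  then show ?case by (intro exI[of _ "[]"] exI[of _ v]) simp
next
  case (Cons x u)
  then obtain p q s where pqs: "u = p @ q" "v = inv_word q @ s" "foldr cancel_Cons u v = p @ s"
    by (auto simp: reduced_Cons)
  show ?case
  proof (cases "p = [] \<and> s \<noteq> [] \<and> hd s = inv_letter x")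
    case True
    then obtain s' where "s = inv_letter x # s'" by (cases s) auto
    moreover from this have "foldr cancel_Cons (x # u) v = s'"
      using True pqs(3) by (simp add: cancel_Cons_def)
    ultimately show ?thesis
      using True pqs(1,2)
      by (intro exI[of _ "[]"] exI[of _ "x # q"] exI[of _ s']) simp
  next
    case False
    have "p = [] \<or> hd p \<noteq> inv_letter x"
      using Cons.prems pqs(1) by (auto simp: reduced_Cons)
    with False have "cancel_Cons x (p @ s) = x # p @ s"
      by (cases p; cases s) (auto simp: cancel_Cons_def)
    then have "foldr cancel_Cons (x # u) v = x # p @ s"
      using pqs(3) by simp
    then show ?thesis
      using pqs(1,2) by (intro exI[of _ "x # p"] exI[of _ q] exI[of _ s]) simp
  qed
qed

text \<open>
  Signed count of the two-letter subwords \<open>A b\<close>, \<open>b A\<close> (positive) and \<open>a B\<close>, \<open>B a\<close> (negative).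
\<close>

definition turn :: "'s \<Rightarrow> 's letter \<Rightarrow> 's letter \<Rightarrow> int"
  where "turn a x y =
    (if fst x = a \<and> fst y \<noteq> a then of_bool (snd y) - of_bool (snd x)
     else if fst x \<noteq> a \<and> fst y = a then of_bool (snd x) - of_bool (snd y) else 0)"

fun turning :: "'s \<Rightarrow> 's letter list \<Rightarrow> int"
  where "turning a (x # y # w) = turn a x y + turning a (y # w)"
  | "turning a w = 0"

lemma abs_turn_le: "\<bar>turn a x y\<bar> \<le> 1"
  by (simp add: turn_def)

lemma turn_inv_letter: "turn a (inv_letter y) (inv_letter x) = - turn a x y"
  by (simp add: turn_def inv_letter_def)

text \<open>Two of the three letters are both \<open>a\<close>-letters or both not, so the turn
  between them vanishes. The sign of the third letter cancels from the other two terms, which leaves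
  at most 1 in absolute value.\<close>

lemma turn_tripod: "\<bar>turn a x z - turn a x y - turn a (inv_letter y) z\<bar> \<le> 1"
  by (simp add: turn_def inv_letter_def)

lemma turning_append:
  "turning a (u @ v) = turning a u + turning a v +
    (if u = [] \<or> v = [] then 0 else turn a (last u) (hd v))"
by (induction a u rule: turning.induct; cases v) auto


lemma turning_inv_word: "turning a (inv_word w) = - turning a w"
  by (induction a w rule: turning.induct)
    (auto simp: turning_append turn_inv_letter last_map)

text \<open>The turns inside the legs \<open>p\<close>, \<open>q\<close>, \<open>s\<close> cancel.
  What remains sits at the centre of the tripod: \<open>turn_tripod\<close> bounds it, or
  \<open>abs_turn_le\<close> if a leg is empty.\<close>

lemma abs_turning_mult_le:
  assumes "reduced u"
  shows "\<bar>turning a (foldr cancel_Cons u v) - turning a u - turning a v\<bar> \<le> 1"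
proof -
  obtain p q s where pqs: "u = p @ q" "v = inv_word q @ s" "foldr cancel_Cons u v = p @ s"
    using foldr_cancel_Cons_decomp[OF assms] by blast
  have "last (inv_word q) = inv_letter (hd q)" if "q \<noteq> []"
    using that by (simp add: last_map last_rev)
  then show ?thesis
    unfolding pqs(3) unfolding pqs(1,2) using abs_turn_le[of a "last p" "hd s"] abs_turn_le[of a "last p" "hd q"]
      abs_turn_le[of a "inv_letter (hd q)" "hd s"] turn_tripod[of a "last p" "hd s" "hd q"]
    by (auto simp: turning_append turning_inv_word abs_le_iff)
qed

text \<open>The values on \<open>x\<close> and \<open>y\<close> cancel against those on their
  inverses. The three products inside a commutator and the one with the remaining factor each
  contribute at most the defect 1.\<close>

lemma turning_commutator_product_le:
  assumes "is_commutator_product (free_group S) n w"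
  shows "turning a w \<le> 4 * int n"
  using assms
proof (induction n arbitrary: w)
  case 0
  then show ?case
    using group.is_commutator_product_cases[OF group_free_group 0] by (auto simp: free_group_def)
next
  case (Suc n)
  interpret F: group "free_group S" by (rule group_free_group)
  obtain x y v where *: "x \<in> carrier (free_group S)" "y \<in> carrier (free_group S)"
      "is_commutator_product (free_group S) n v"
      "w = (x \<otimes>\<^bsub>free_group S\<^esub> y \<otimes>\<^bsub>free_group S\<^esub> inv\<^bsub>free_group S\<^esub> x \<otimes>\<^bsub>free_group S\<^esub> inv\<^bsub>free_group S\<^esub> y)
        \<otimes>\<^bsub>free_group S\<^esub> v"
    using F.is_commutator_product_cases[OF Suc.prems] by blast
  have mult: "turning a (u \<otimes>\<^bsub>free_group S\<^esub> v) \<le> turning a u + turning a v + 1"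
    if "u \<in> carrier (free_group S)" for u v
    using that abs_turning_mult_le[of u a v] by (simp add: free_group_def)
  have neg: "turning a (inv\<^bsub>free_group S\<^esub> u) = - turning a u" if "u \<in> carrier (free_group S)" for u
    using that by (simp add: inv_free_group turning_inv_word)
  show ?case
    using * Suc.IH[OF *(3)] mult[of x y] mult[of "x \<otimes>\<^bsub>free_group S\<^esub> y" "inv\<^bsub>free_group S\<^esub> x"]
      mult[of "x \<otimes>\<^bsub>free_group S\<^esub> y \<otimes>\<^bsub>free_group S\<^esub> inv\<^bsub>free_group S\<^esub> x" "inv\<^bsub>free_group S\<^esub> y"]
      mult[of "x \<otimes>\<^bsub>free_group S\<^esub> y \<otimes>\<^bsub>free_group S\<^esub> inv\<^bsub>free_group S\<^esub> x \<otimes>\<^bsub>free_group S\<^esub> inv\<^bsub>free_group S\<^esub> y" v]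
      neg[of x] neg[of y]
    by simp
qed


section \<open>The stable commutator length of the relator\<close>

definition relator :: "'s \<Rightarrow> 's \<Rightarrow> 's letter list"
  where "relator a b =
    [pos a, pos a, pos b, neg a, neg b, pos a, pos b, neg a, neg b, neg b,
     neg a, pos b, pos a, pos a, pos b, neg a, neg b, neg b, neg a, pos b]"

lemma relator_closed:
  "a \<noteq> b \<Longrightarrow> relator a b \<in> carrier (free_group {a, b})"
  by (simp add: relator_def free_group_def reduced_Cons inv_letter_def)

lemma turning_relator_pow:
  assumes "a \<noteq> b"
  shows "turning a (relator a b [^]\<^bsub>free_group {a, b}\<^esub> (n::nat)) = 4 * int n"
proof -
  interpret F: group "free_group {a, b}" by (rule group_free_group)
  let ?w = "\<lambda>n::nat. relator a b [^]\<^bsub>free_group {a, b}\<^esub> n"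
  \<comment> \<open>The first letter is carried along because the relator ends in
    \<open>pos b\<close>: nothing cancels at the seam, and the turn from \<open>pos b\<close> to
    \<open>pos a\<close> counts 0.\<close>
  have "turning a (?w n) = 4 * int n \<and> (?w n = [] \<or> hd (?w n) = pos a)"
  proof (induction n)
    case 0
    then show ?case by (simp add: free_group_def)
  next
    case (Suc n)
    have "cancel_Cons (pos b) (?w n) = pos b # ?w n"
      using Suc assms by (auto simp: cancel_Cons_def inv_letter_def split: list.splits)
    then have "foldr cancel_Cons (relator a b) (?w n) = relator a b @ ?w n"
      using assms by (simp add: relator_def cancel_Cons_def inv_letter_def)
    then have "?w (Suc n) = relator a b @ ?w n"
      using F.nat_pow_Suc2[OF relator_closed[OF assms]] by (simp add: free_group_def)
    moreover have "turning a (relator a b) = 4" "last (relator a b) = pos b" "relator a b \<noteq> []"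
      "hd (relator a b) = pos a"
      using assms by (simp_all add: relator_def turn_def)
    ultimately show ?case
      using Suc assms by (auto simp: turning_append turn_def)
  qed
  then show ?thesis by blast
qed

text \<open>The relator as a word map on an arbitrary group, since it is evaluated in the free
  group, in the one-relator group and in a quotient of the free group where it is only
  central.\<close>

definition (in group) relator_value :: "'a \<Rightarrow> 'a \<Rightarrow> 'a"
  where "relator_value a b =
    (let y = a \<otimes> b \<otimes> inv a \<otimes> inv b; x = inv b \<otimes> inv a \<otimes> inv (inv b) \<otimes> inv (inv a)
     in a \<otimes> (y \<otimes> (y \<otimes> (x \<otimes> (y \<otimes> x)))) \<otimes> inv a)"

lemma (in group) is_commutator_product_relator_value:
  assumes "a \<in> carrier G" "b \<in> carrier G"
  shows "is_commutator_product G 5 (relator_value a b)"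
proof -
  define y where "y = a \<otimes> b \<otimes> inv a \<otimes> inv b"
  define x where "x = inv b \<otimes> inv a \<otimes> inv (inv b) \<otimes> inv (inv a)"
  have "is_commutator_product G 1 y" "is_commutator_product G 1 x"
    unfolding x_def y_def using assms by (intro is_commutator_product_commutator inv_closed; simp)+
  then have "is_commutator_product G (1 + (1 + (1 + (1 + 1))))
      (a \<otimes> (y \<otimes> (y \<otimes> (x \<otimes> (y \<otimes> x)))) \<otimes> inv a)"
    using assms by (intro is_commutator_product_conj is_commutator_product_mult)
  then show ?thesis by (simp add: relator_value_def Let_def x_def y_def numeral_eq_Suc)
qed

lemma inv_free_group_letter:
  "fst x \<in> S \<Longrightarrow> inv\<^bsub>free_group S\<^esub> [x] = [inv_letter x]"
  by (subst inv_free_group) (auto simp: free_group_def reduced_Cons)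

lemma relator_eq:
  assumes "a \<noteq> b"
  shows "relator a b = group.relator_value (free_group {a, b}) [pos a] [pos b]"
proof -
  interpret F: group "free_group {a, b}" by (rule group_free_group)
  have [simp]: "[neg a] \<in> carrier (free_group {a, b})" "[neg b] \<in> carrier (free_group {a, b})"
     "[pos a] \<in> carrier (free_group {a, b})" "[pos b] \<in> carrier (free_group {a, b})"
    by (auto simp: free_group_def reduced_Cons)
  have "(u \<otimes>\<^bsub>free_group {a, b}\<^esub> v) = foldr cancel_Cons u v" for u v :: "'a letter list"
    by (simp add: free_group_def)
  then show ?thesis
    using assms unfolding F.relator_value_def Let_def relator_def
    by (simp add: inv_free_group_letter inv_letter_def cancel_Cons_def)
qed

text \<open>
  The witnesses come from an extremal surface for the relator: it has genus two and two boundary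
  components, each winding once around the relator.
\<close>

lemma relator_mult_conj:
  assumes "a \<noteq> b"
  shows "\<exists>h x y u v. {h, x, y, u, v} \<subseteq> carrier (free_group {a, b}) \<and>
    relator a b \<otimes>\<^bsub>free_group {a, b}\<^esub> (h \<otimes>\<^bsub>free_group {a, b}\<^esub> relator a b \<otimes>\<^bsub>free_group {a, b}\<^esub> inv\<^bsub>free_group {a, b}\<^esub> h) =
    (x \<otimes>\<^bsub>free_group {a, b}\<^esub> y \<otimes>\<^bsub>free_group {a, b}\<^esub> inv\<^bsub>free_group {a, b}\<^esub> x \<otimes>\<^bsub>free_group {a, b}\<^esub> inv\<^bsub>free_group {a, b}\<^esub> y) \<otimes>\<^bsub>free_group {a, b}\<^esub>
    (u \<otimes>\<^bsub>free_group {a, b}\<^esub> v \<otimes>\<^bsub>free_group {a, b}\<^esub> inv\<^bsub>free_group {a, b}\<^esub> u \<otimes>\<^bsub>free_group {a, b}\<^esub> inv\<^bsub>free_group {a, b}\<^esub> v)"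
proof -
  let ?F = "free_group {a, b}"
  define h where "h = [pos a, neg b, neg a, neg a]"
  define x where "x = [pos a, pos a, pos b, neg a, neg b, pos a, pos b, neg a, neg b, neg a, neg a]"
  define y where "y = [pos a, pos a, neg b, neg a, pos b, pos a, pos a, pos b, neg a, neg b, neg a, neg b, neg a, neg b, neg a, neg a]"
  define u where "u = [pos a, pos a, neg b, neg a, pos b, pos b, pos a, pos a, pos b, neg a]"
  define v where "v = [pos a, neg b, neg a, neg a, neg b, pos a, pos a, pos b, neg a, neg a]"
  have c: "h \<in> carrier ?F" "x \<in> carrier ?F" "y \<in> carrier ?F" "u \<in> carrier ?F" "v \<in> carrier ?F"
    using assms by (simp_all add: h_def x_def y_def u_def v_def free_group_def reduced_Cons inv_letter_def)
  have m: "(p \<otimes>\<^bsub>free_group {a, b}\<^esub> q) = foldr cancel_Cons p q" for p q :: "'a letter list"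
    by (simp add: free_group_def)
  show ?thesis
    by (rule exI[of _ h], rule exI[of _ x], rule exI[of _ y], rule exI[of _ u], rule exI[of _ v])
     (use c assms in \<open>simp add: inv_free_group m, simp add: h_def x_def y_def u_def v_def relator_def inv_letter_def cancel_Cons_def\<close>)
qed

text \<open>The commutator length of the \<open>n\<close>-th power lies between \<open>n\<close> and
  \<open>n + 18\<close>, so the quotients converge to 1.\<close>

lemma scl_relator:
  assumes "a \<noteq> b"
  shows "scl (free_group {a, b}) (relator a b) = 1"
proof -
  let ?F = "free_group {a, b}" and ?r = "relator a b"
  interpret F: group ?F by (rule group_free_group)
  have ab: "[pos a] \<in> carrier ?F" "[pos b] \<in> carrier ?F"
    by (simp_all add: free_group_def reduced_Cons)
  obtain h x y u v where *: "h \<in> carrier ?F" "x \<in> carrier ?F" "y \<in> carrier ?F" "u \<in> carrier ?F"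
      "v \<in> carrier ?F"
    and eq: "?r \<otimes>\<^bsub>?F\<^esub> (h \<otimes>\<^bsub>?F\<^esub> ?r \<otimes>\<^bsub>?F\<^esub> inv\<^bsub>?F\<^esub> h) =
      (x \<otimes>\<^bsub>?F\<^esub> y \<otimes>\<^bsub>?F\<^esub> inv\<^bsub>?F\<^esub> x \<otimes>\<^bsub>?F\<^esub> inv\<^bsub>?F\<^esub> y) \<otimes>\<^bsub>?F\<^esub> (u \<otimes>\<^bsub>?F\<^esub> v \<otimes>\<^bsub>?F\<^esub> inv\<^bsub>?F\<^esub> u \<otimes>\<^bsub>?F\<^esub> inv\<^bsub>?F\<^esub> v)"
    using relator_mult_conj[OF assms] by (auto simp only: insert_subset)
  \<comment> \<open>Up to three copies of the relator are left over after division by 4. Each costs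
    five commutators, and \<open>3 + 3 * 5 = 18\<close>.\<close>
  have upper: "is_commutator_product ?F (n + 18) (?r [^]\<^bsub>?F\<^esub> n)" for n
  proof -
    have "is_commutator_product ?F ((4 * (n div 4) + 3) + (n mod 4) * 5)
        (?r [^]\<^bsub>?F\<^esub> (4 * (n div 4)) \<otimes>\<^bsub>?F\<^esub> ?r [^]\<^bsub>?F\<^esub> (n mod 4))"
      using F.pow_4_commutator_product[OF relator_closed[OF assms] * eq]
        F.is_commutator_product_relator_value[OF ab]
      by (intro F.is_commutator_product_mult F.is_commutator_product_pow)
        (simp_all add: relator_eq[OF assms])
    moreover have "?r [^]\<^bsub>?F\<^esub> (4 * (n div 4)) \<otimes>\<^bsub>?F\<^esub> ?r [^]\<^bsub>?F\<^esub> (n mod 4) = ?r [^]\<^bsub>?F\<^esub> n"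
      using relator_closed[OF assms] by (simp add: F.nat_pow_mult)
    moreover have "n mod 4 < 4" by simp
    then have "(4 * (n div 4) + 3) + (n mod 4) * 5 \<le> n + 18"
      using mult_div_mod_eq[of 4 n] by linarith
    ultimately show ?thesis using F.is_commutator_product_mono by metis
  qed
  have cl_le: "cl ?F (?r [^]\<^bsub>?F\<^esub> n) \<le> n + 18" for n
    unfolding cl_def by (rule Least_le) (rule upper)
  \<comment> \<open>The quasimorphism takes the value \<open>4 n\<close> on the power and is at most
    four times its commutator length.\<close>
  have cl_ge: "n \<le> cl ?F (?r [^]\<^bsub>?F\<^esub> n)" for n
  proof -
    have "is_commutator_product ?F (cl ?F (?r [^]\<^bsub>?F\<^esub> n)) (?r [^]\<^bsub>?F\<^esub> n)"
      unfolding cl_def by (rule LeastI) (rule upper)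
    from turning_commutator_product_le[OF this, of a] show ?thesis
      by (simp add: turning_relator_pow[OF assms])
  qed
  have "(\<lambda>n. real (cl ?F (?r [^]\<^bsub>?F\<^esub> n)) / real n) \<longlonglongrightarrow> 1"
  proof (rule tendsto_sandwich)
    show "\<forall>\<^sub>F n in sequentially. 1 \<le> real (cl ?F (?r [^]\<^bsub>?F\<^esub> n)) / real n"
      using eventually_gt_at_top[of 0] by eventually_elim (use cl_ge in simp)
    show "\<forall>\<^sub>F n in sequentially. real (cl ?F (?r [^]\<^bsub>?F\<^esub> n)) / real n \<le> 1 + 18 / real n"
      using eventually_gt_at_top[of 0]
    proof eventually_elim
      case (elim n)
      have "real (cl ?F (?r [^]\<^bsub>?F\<^esub> n)) \<le> real n + 18"
        using cl_le[of n] by linarith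
      then show ?case using elim by (simp add: field_simps)
    qed
    show "(\<lambda>n. 1 + 18 / real n) \<longlonglongrightarrow> 1"
      using tendsto_add[OF tendsto_const[of 1] lim_const_over_n[of "18::real"]] by simp
  qed simp
  then show ?thesis unfolding scl_def by (rule limI)
qed

lemma relator_derived:
  assumes "a \<noteq> b"
  shows "relator a b \<in> derived (free_group {a, b}) (carrier (free_group {a, b}))"
proof -
  let ?F = "free_group {a, b}"
  interpret F: group ?F by (rule group_free_group)
  have "w \<in> derived (free_group {a, b}) (carrier (free_group {a, b}))"
    if "is_commutator_product (free_group {a, b}) n w" for n w
    using that
  proof (induction n arbitrary: w)
    case 0
    then show ?case
      using F.is_commutator_product_cases[OF 0] by (auto simp: derived_def intro: generate.one)
  next
    case (Suc n)
    show ?case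
      using F.is_commutator_product_cases[OF Suc.prems]
    proof (elim disjE exE conjE)
      fix k x y v
      assume "Suc n = Suc k" and xy: "x \<in> carrier ?F" "y \<in> carrier ?F"
        and "is_commutator_product ?F k v"
        and w: "w = x \<otimes>\<^bsub>?F\<^esub> y \<otimes>\<^bsub>?F\<^esub> inv\<^bsub>?F\<^esub> x \<otimes>\<^bsub>?F\<^esub> inv\<^bsub>?F\<^esub> y \<otimes>\<^bsub>?F\<^esub> v"
      then have "v \<in> derived ?F (carrier ?F)" using Suc.IH by simp
      then show ?thesis
        unfolding w derived_def by (rule generate.eng[OF generate.incl[OF F.derived_setI[OF xy]]])
    qed simp
  qed
  moreover have "[pos a] \<in> carrier (free_group {a, b})" "[pos b] \<in> carrier (free_group {a, b})"
    by (simp_all add: free_group_def reduced_Cons)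
  ultimately show ?thesis
    unfolding relator_eq[OF assms] by (blast intro: F.is_commutator_product_relator_value)
qed

section \<open>A torus in the one-relator group\<close>

text \<open>The element \<open>a t^6\<close>, the partner of \<open>a b\<close>: the two commute as
  soon as the relator is trivial.\<close>

definition (in group) torus_meridian :: "'a \<Rightarrow> 'a \<Rightarrow> 'a"
  where "torus_meridian a b =
    (let y = a \<otimes> b \<otimes> inv a \<otimes> inv b; x = inv b \<otimes> inv a \<otimes> inv (inv b) \<otimes> inv (inv a); t = y \<otimes> x
     in a \<otimes> ((t \<otimes> t \<otimes> t) \<otimes> (t \<otimes> t \<otimes> t)))"

text \<open>
  If \<open>z\<close>, the value of the relator, is central, then \<open>t = y x\<close> satisfies \<open>y = z t\<^sup>-\<^sup>2\<close> and
  \<open>x = z\<^sup>-\<^sup>1 t\<^sup>3\<close>. As \<open>p = a b\<close> conjugates \<open>y\<close> into \<open>x\<^sup>-\<^sup>1\<close>, it satisfies the Baumslag-Solitar relation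
  \<open>t\<^sup>2 p = p t\<^sup>3\<close>, so that \<open>a\<^sup>-\<^sup>1 p a = y\<^sup>-\<^sup>1 p = z\<^sup>-\<^sup>1 t\<^sup>2 p = z\<^sup>-\<^sup>1 t\<^sup>6 p t\<^sup>-\<^sup>6\<close>.
\<close>

lemma (in group) torus_commutator:
  assumes ab: "a \<in> carrier G" "b \<in> carrier G"
    and za: "relator_value a b \<otimes> a = a \<otimes> relator_value a b"
    and zb: "relator_value a b \<otimes> b = b \<otimes> relator_value a b"
  shows "torus_meridian a b \<otimes> (a \<otimes> b) = relator_value a b \<otimes> ((a \<otimes> b) \<otimes> torus_meridian a b)"
proof -
  define z where "z = relator_value a b"
  define y where "y = a \<otimes> b \<otimes> inv a \<otimes> inv b"
  define x where "x = inv b \<otimes> inv a \<otimes> inv (inv b) \<otimes> inv (inv a)"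
  define t where "t = y \<otimes> x"
  define p where "p = a \<otimes> b"
  have cl [simp]: "a \<in> carrier G" "b \<in> carrier G" "y \<in> carrier G" "x \<in> carrier G" "t \<in> carrier G"
      "p \<in> carrier G"
    using ab by (simp_all add: t_def p_def x_def y_def)
  have z_eq: "z = a \<otimes> (y \<otimes> (y \<otimes> (x \<otimes> (y \<otimes> x)))) \<otimes> inv a"
    by (simp add: z_def relator_value_def Let_def x_def y_def)
  have z [simp]: "z \<in> carrier G" by (simp add: z_eq)
  have comm_mult: "z \<otimes> (u \<otimes> v) = (u \<otimes> v) \<otimes> z"
    if "z \<otimes> u = u \<otimes> z" "z \<otimes> v = v \<otimes> z" "u \<in> carrier G" "v \<in> carrier G" for u v
    using that by (metis m_assoc z)
  have comm_inv: "z \<otimes> inv u = inv u \<otimes> z" if "z \<otimes> u = u \<otimes> z" "u \<in> carrier G" for u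
    using that by (metis inv_closed inv_mult_cancel_left inv_solve_right m_assoc z m_closed)
  have za: "z \<otimes> a = a \<otimes> z" and zb: "z \<otimes> b = b \<otimes> z" using za zb by (simp_all add: z_def)
  have zy: "z \<otimes> y = y \<otimes> z" and zx: "z \<otimes> x = x \<otimes> z" and zp: "z \<otimes> p = p \<otimes> z"
    unfolding y_def x_def p_def by (intro comm_mult comm_inv za zb; simp)+
  have zt: "z \<otimes> t = t \<otimes> z" unfolding t_def by (intro comm_mult zy zx; simp)
  have ytt: "y \<otimes> (t \<otimes> t) = z"
  proof -
    have "a \<otimes> (y \<otimes> (t \<otimes> t)) = z \<otimes> a"
      by (simp add: z_eq t_def m_assoc)
    then show ?thesis by (simp add: za)
  qed
  have inv_y: "inv y = inv z \<otimes> (t \<otimes> t)"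
  proof -
    have "t \<otimes> t = inv y \<otimes> z" by (simp flip: ytt)
    then have "inv z \<otimes> (t \<otimes> t) = inv z \<otimes> (z \<otimes> inv y)"
      using comm_inv[OF zy] by simp
    then show ?thesis by simp
  qed
  have "p \<otimes> inv x = y \<otimes> p"
    by (simp add: p_def y_def x_def inv_mult_group m_assoc)
  then have "inv y \<otimes> p = p \<otimes> x"
    by (metis cl(3,4,6) inv_closed inv_inv inv_mult_cancel_left m_assoc m_closed r_inv r_one)
  moreover have "x = inv z \<otimes> (t \<otimes> t \<otimes> t)"
  proof -
    have "x = inv y \<otimes> t" by (simp add: t_def)
    then show ?thesis by (simp add: inv_y m_assoc)
  qed
  ultimately have "inv z \<otimes> ((t \<otimes> t) \<otimes> p) = inv z \<otimes> (p \<otimes> (t \<otimes> t \<otimes> t))"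
    using zp by (simp add: inv_y m_assoc) (metis comm_inv inv_closed inv_comm m_assoc cl z m_closed inv_mult_cancel_left mult_inv_cancel_left)
  then have BS: "p \<otimes> (t \<otimes> t \<otimes> t) = (t \<otimes> t) \<otimes> p" by simp
  have pa: "p \<otimes> a = a \<otimes> (inv y \<otimes> p)"
    by (simp add: p_def y_def inv_mult_group m_assoc)
  define w where "w = t \<otimes> t \<otimes> t"
  define u where "u = t \<otimes> t"
  have [simp]: "w \<in> carrier G" "u \<in> carrier G" by (simp_all add: w_def u_def)
  have BS': "p \<otimes> w = u \<otimes> p" using BS by (simp only: w_def u_def)
  \<comment> \<open>This is where the exponent six comes from: one \<open>u\<close> arises from
    moving \<open>p\<close> past \<open>a\<close> and two from moving it past \<open>w w\<close>,
    and \<open>u^3 = t^6 = w^2\<close>.\<close>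
  have "z \<otimes> (p \<otimes> (a \<otimes> (w \<otimes> w))) = z \<otimes> ((p \<otimes> a) \<otimes> (w \<otimes> w))"
    by (simp add: m_assoc)
  also have "\<dots> = (z \<otimes> a) \<otimes> (inv z \<otimes> (u \<otimes> (p \<otimes> w \<otimes> w)))"
    by (simp add: pa inv_y u_def m_assoc)
  also have "\<dots> = a \<otimes> (u \<otimes> (p \<otimes> w \<otimes> w))"
    by (simp add: za m_assoc)
  also have "p \<otimes> w \<otimes> w = u \<otimes> (p \<otimes> w)"
    by (subst BS') (simp add: m_assoc)
  also have "\<dots> = u \<otimes> (u \<otimes> p)"
    by (simp only: BS')
  also have "a \<otimes> (u \<otimes> (u \<otimes> (u \<otimes> p))) = a \<otimes> (w \<otimes> w) \<otimes> p"
    by (simp add: u_def w_def m_assoc)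
  finally have "z \<otimes> (p \<otimes> (a \<otimes> (w \<otimes> w))) = a \<otimes> (w \<otimes> w) \<otimes> p" .
  moreover have "torus_meridian a b = a \<otimes> (w \<otimes> w)"
    by (simp only: torus_meridian_def Let_def w_def t_def x_def y_def)
  ultimately show ?thesis by (simp flip: p_def z_def)
qed

section \<open>Two-cocycles on free groups\<close>

text \<open>An additive subgroup. The quotient by \<open>B\<close> is never formed; congruences are
  written as membership of a difference in \<open>B\<close>.\<close>

locale diff_closed =
  fixes B :: "'c::ab_group_add set"
  assumes zero_mem [simp]: "0 \<in> B"
    and diff_mem: "x \<in> B \<Longrightarrow> y \<in> B \<Longrightarrow> x - y \<in> B"
begin

lemma uminus_mem: "x \<in> B \<Longrightarrow> - x \<in> B"
  using diff_mem[of 0 x] by simp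

lemma add_mem: "x \<in> B \<Longrightarrow> y \<in> B \<Longrightarrow> x + y \<in> B"
  using diff_mem[of x "- y"] uminus_mem by simp

end

text \<open>
  \<open>e\<close> is a normalized 2-cocycle on \<open>G\<close> with values in the quotient by \<open>B\<close>. Its pullback to the
  free group is the coboundary of \<open>prim\<close>.
\<close>

locale free_cocycle = diff_closed B + G: group G
  for B :: "'c::ab_group_add set" and G :: "('g, 'm) monoid_scheme" (structure) +
  fixes S :: "'s set" and \<pi> :: "'s letter list \<Rightarrow> 'g" and e :: "'g \<Rightarrow> 'g \<Rightarrow> 'c"
  assumes hom: "\<pi> \<in> hom (free_group S) G"
    and e_one: "e \<one> \<one> = 0"
    and cocycle: "g \<in> carrier G \<Longrightarrow> h \<in> carrier G \<Longrightarrow> k \<in> carrier G \<Longrightarrow>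
      e h k - e (g \<otimes> h) k + e g (h \<otimes> k) - e g h \<in> B"
begin

abbreviation F :: "'s letter list monoid" where "F \<equiv> free_group S"

sublocale F: group F by (rule group_free_group)

sublocale \<pi>: group_hom F G \<pi>
  by unfold_locales (rule hom)

text \<open>A primitive may be prescribed on the generators, and 0 is chosen there. Its value on
  inverse letters is then forced modulo \<open>B\<close> by \<open>prim [] = 0\<close>.\<close>

definition letter_prim :: "'s letter \<Rightarrow> 'c"
  where "letter_prim x = (if snd x then 0 else e (\<pi> [inv_letter x]) (\<pi> [x]))"

text \<open>The coboundary equation
  \<open>prim u + prim v - prim (u v) = e (\<pi> u) (\<pi> v)\<close> for a single letter
  \<open>u\<close>, used as a recursion along the reduced word.\<close>

fun prim :: "'s letter list \<Rightarrow> 'c"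
  where "prim [] = 0"
  | "prim (x # w) = letter_prim x + prim w - e (\<pi> [x]) (\<pi> w)"

lemma e_one_left: "g \<in> carrier G \<Longrightarrow> e \<one> g \<in> B"
  using cocycle[of \<one> \<one> g] by (simp add: e_one)

lemma e_one_right: "g \<in> carrier G \<Longrightarrow> e g \<one> \<in> B"
  using cocycle[of g \<one> \<one>] uminus_mem[of "- e g \<one>"] by (simp add: e_one)

lemma letter_closed: "fst x \<in> S \<Longrightarrow> [x] \<in> carrier F"
  by (simp add: free_group_def reduced_Cons)

lemma letter_mult_inv: "fst x \<in> S \<Longrightarrow> \<pi> [x] \<otimes> \<pi> [inv_letter x] = \<one>"
  using \<pi>.hom_inv[OF letter_closed[of x]] letter_closed[of x]
  by (simp add: inv_free_group_letter)

text \<open>For a negative letter, the cocycle identity at \<open>g\<close>, \<open>g^-1\<close>,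
  \<open>g\<close> shows that \<open>e\<close> takes the same value modulo \<open>B\<close> on
  \<open>g\<close>, \<open>g^-1\<close> and on \<open>g^-1\<close>, \<open>g\<close>.\<close>

lemma letter_prim_inv:
  assumes "fst x \<in> S"
  shows "letter_prim x + letter_prim (inv_letter x) - e (\<pi> [x]) (\<pi> [inv_letter x]) \<in> B"
proof (cases "snd x")
  case False
  define g where "g = \<pi> [x]"
  define h where "h = \<pi> [inv_letter x]"
  have cl: "g \<in> carrier G" "h \<in> carrier G"
    using assms by (auto simp: g_def h_def intro!: \<pi>.hom_closed letter_closed)
  have "g \<otimes> h = \<one>" "h \<otimes> g = \<one>"
    using letter_mult_inv[of x] letter_mult_inv[of "inv_letter x"] assms by (simp_all add: g_def h_def)
  then have "e h g - e \<one> g + e g \<one> - e g h \<in> B"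
    using cocycle[of g h g] cl by simp
  from add_mem[OF diff_mem[OF this e_one_right[OF cl(1)]] e_one_left[OF cl(1)]]
  show ?thesis
    using False by (simp add: letter_prim_def inv_letter_def[of x] algebra_simps flip: g_def h_def)
      (simp add: g_def h_def inv_letter_def algebra_simps)
qed (simp add: letter_prim_def, simp add: inv_letter_def)

text \<open>The recursion for \<open>prim\<close> survives cancellation, by the cocycle identity at
  a letter, its inverse and the rest of the word.\<close>

lemma prim_cancel_Cons:
  assumes x: "fst x \<in> S" and w: "w \<in> carrier F"
  shows "prim (cancel_Cons x w) - (letter_prim x + prim w - e (\<pi> [x]) (\<pi> w)) \<in> B"
proof (cases "w \<noteq> [] \<and> hd w = inv_letter x")
  case True
  then obtain v where v: "w = inv_letter x # v" by (cases w) auto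
  then have vF: "v \<in> carrier F" using w by (simp add: free_group_def reduced_Cons)
  have w_eq: "w = [inv_letter x] \<otimes>\<^bsub>F\<^esub> v"
    using v w by (auto simp: free_group_def cancel_Cons_def reduced_Cons split: list.splits)
  have cl: "\<pi> [x] \<in> carrier G" "\<pi> [inv_letter x] \<in> carrier G" "\<pi> v \<in> carrier G"
    using x vF by (auto intro!: \<pi>.hom_closed letter_closed)
  have \<pi>w: "\<pi> w = \<pi> [inv_letter x] \<otimes> \<pi> v"
    unfolding w_eq using x vF by (intro \<pi>.hom_mult letter_closed) auto
  have "e (\<pi> [inv_letter x]) (\<pi> v) - e \<one> (\<pi> v) + e (\<pi> [x]) (\<pi> w) - e (\<pi> [x]) (\<pi> [inv_letter x]) \<in> B"
    using cocycle[OF cl] letter_mult_inv[OF x] by (simp add: \<pi>w)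
  from diff_mem[OF add_mem[OF this e_one_left[OF cl(3)]] letter_prim_inv[OF x]]
  show ?thesis unfolding v by (simp add: cancel_Cons_def algebra_simps)
next
  case False
  then have "cancel_Cons x w = x # w" by (auto simp: cancel_Cons_def split: list.splits)
  then show ?thesis by simp
qed

lemma Cons_eq_mult: "x # w \<in> carrier F \<Longrightarrow> x # w = [x] \<otimes>\<^bsub>F\<^esub> w"
  by (auto simp: free_group_def cancel_Cons_def reduced_Cons split: list.splits)

text \<open>Every 2-cocycle becomes a coboundary on a free group. The induction step is the cocycle
  identity at the images of the first letter, of \<open>u\<close> and of \<open>v\<close>.\<close>

lemma prim_mult:
  assumes "u \<in> carrier F" "v \<in> carrier F"
  shows "prim (u \<otimes>\<^bsub>F\<^esub> v) - (prim u + prim v - e (\<pi> u) (\<pi> v)) \<in> B"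
  using assms(1)
proof (induction u)
  case Nil
  have "\<pi> [] = \<one>" "[] \<otimes>\<^bsub>F\<^esub> v = v"
    using \<pi>.hom_one by (simp_all add: free_group_def)
  then show ?case using e_one_left assms(2) by simp
next
  case (Cons x u)
  then have x: "fst x \<in> S" and u: "u \<in> carrier F" by (auto simp: free_group_def reduced_Cons)
  have mult: "(x # u) \<otimes>\<^bsub>F\<^esub> v = cancel_Cons x (u \<otimes>\<^bsub>F\<^esub> v)"
    by (simp add: free_group_def)
  have cl: "\<pi> [x] \<in> carrier G" "\<pi> u \<in> carrier G" "\<pi> v \<in> carrier G"
    using x u assms(2) by (auto intro!: \<pi>.hom_closed letter_closed)
  have "\<pi> (x # u) = \<pi> [x] \<otimes> \<pi> u"
    unfolding Cons_eq_mult[OF Cons.prems] using x u by (intro \<pi>.hom_mult letter_closed) auto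
  then have c: "e (\<pi> u) (\<pi> v) - e (\<pi> (x # u)) (\<pi> v) + e (\<pi> [x]) (\<pi> (u \<otimes>\<^bsub>F\<^esub> v)) - e (\<pi> [x]) (\<pi> u) \<in> B"
    using cocycle[OF cl] u assms(2) by simp
  show ?case
    using diff_mem[OF add_mem[OF prim_cancel_Cons[OF x F.m_closed[OF u assms(2)]] Cons.IH[OF u]] c]
    unfolding mult by (simp add: algebra_simps)
qed

text \<open>Normalization puts the term \<open>e\<close> into \<open>B\<close>. Hence
  \<open>prim\<close> restricts to a homomorphism modulo \<open>B\<close> on the kernel of \<pi>, as
  in Hopf's formula.\<close>

lemma prim_kernel_mult:
  assumes "n \<in> carrier F" "\<pi> n = \<one>" "f \<in> carrier F"
  shows "prim (n \<otimes>\<^bsub>F\<^esub> f) - (prim n + prim f) \<in> B"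
  using diff_mem[OF prim_mult[OF assms(1,3)] e_one_left[of "\<pi> f"]] assms by (simp add: algebra_simps)

lemma prim_mult_kernel:
  assumes "n \<in> carrier F" "\<pi> n = \<one>" "f \<in> carrier F"
  shows "prim (f \<otimes>\<^bsub>F\<^esub> n) - (prim f + prim n) \<in> B"
  using diff_mem[OF prim_mult[OF assms(3,1)] e_one_right[of "\<pi> f"]] assms by (simp add: algebra_simps)

text \<open>Used with \<open>D = B\<close> to obtain a quotient in which the kernel of \<pi> is
  central, and with a larger \<open>D\<close> to control \<open>prim\<close> on a normal
  closure.\<close>

definition prim_kernel :: "'c set \<Rightarrow> 's letter list set"
  where "prim_kernel D = {n \<in> carrier F. \<pi> n = \<one> \<and> prim n \<in> D}"

text \<open>For a conjugate \<open>m = f n f^-1\<close> the words \<open>m f\<close> and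
  \<open>f n\<close> agree. Computing \<open>prim\<close> on both sides gives \<open>prim m\<close>
  and \<open>prim n\<close> congruent modulo \<open>D\<close>.\<close>

lemma normal_prim_kernel:
  assumes D: "diff_closed D" "B \<subseteq> D"
  shows "prim_kernel D \<lhd> F"
proof -
  interpret D: diff_closed D by (rule D(1))
  have "subgroup (prim_kernel D) F"
  proof (rule F.subgroupI)
    have "[] \<in> prim_kernel D"
      using F.one_closed \<pi>.hom_one by (simp add: prim_kernel_def free_group_def)
    then show "prim_kernel D \<noteq> {}" by blast
  next
    fix u assume "u \<in> prim_kernel D"
    then have u: "u \<in> carrier F" "\<pi> u = \<one>" "prim u \<in> D" by (simp_all add: prim_kernel_def)
    have "\<one>\<^bsub>F\<^esub> = []" by (simp add: free_group_def)
    then have "prim (u \<otimes>\<^bsub>F\<^esub> inv\<^bsub>F\<^esub> u) = 0" using u(1) by simp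
    then have "- (prim u + prim (inv\<^bsub>F\<^esub> u)) \<in> D"
      using prim_kernel_mult[OF u(1,2), of "inv\<^bsub>F\<^esub> u"] u(1) D(2) by auto
    from D.diff_mem[OF D.uminus_mem[OF this] u(3)]
    show "inv\<^bsub>F\<^esub> u \<in> prim_kernel D" using u by (simp add: prim_kernel_def)
  next
    fix u v assume "u \<in> prim_kernel D" "v \<in> prim_kernel D"
    then have u: "u \<in> carrier F" "\<pi> u = \<one>" "prim u \<in> D"
      and v: "v \<in> carrier F" "\<pi> v = \<one>" "prim v \<in> D" by (simp_all add: prim_kernel_def)
    have "prim (u \<otimes>\<^bsub>F\<^esub> v) - (prim u + prim v) \<in> D"
      using prim_kernel_mult[OF u(1,2) v(1)] D(2) by blast
    from D.add_mem[OF this D.add_mem[OF u(3) v(3)]]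
    show "u \<otimes>\<^bsub>F\<^esub> v \<in> prim_kernel D" using u v by (simp add: prim_kernel_def)
  qed (auto simp: prim_kernel_def)
  moreover have "f \<otimes>\<^bsub>F\<^esub> n \<otimes>\<^bsub>F\<^esub> inv\<^bsub>F\<^esub> f \<in> prim_kernel D"
    if f: "f \<in> carrier F" and "n \<in> prim_kernel D" for f n
  proof -
    have n: "n \<in> carrier F" "\<pi> n = \<one>" "prim n \<in> D" using that by (simp_all add: prim_kernel_def)
    let ?m = "f \<otimes>\<^bsub>F\<^esub> n \<otimes>\<^bsub>F\<^esub> inv\<^bsub>F\<^esub> f"
    have m: "?m \<in> carrier F" "\<pi> ?m = \<one>" using f n by auto
    have "?m \<otimes>\<^bsub>F\<^esub> f = f \<otimes>\<^bsub>F\<^esub> n" using f n by (simp add: F.m_assoc)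
    then have 1: "prim (f \<otimes>\<^bsub>F\<^esub> n) - (prim ?m + prim f) \<in> D"
      using prim_kernel_mult[OF m f] D(2) by auto
    have 2: "prim (f \<otimes>\<^bsub>F\<^esub> n) - (prim f + prim n) \<in> D"
      using prim_mult_kernel[OF n(1,2) f] D(2) by auto
    from D.add_mem[OF n(3) D.diff_mem[OF 2 1]]
    show ?thesis using m by (simp add: prim_kernel_def algebra_simps)
  qed
  ultimately show ?thesis unfolding F.normal_inv_iff by blast
qed

text \<open>Modulo \<open>B\<close>, \<open>prim\<close> takes the same value on \<open>n f\<close>
  and \<open>f n\<close>, so their quotient has \<open>prim\<close> in \<open>B\<close>.\<close>

lemma commutator_mem_prim_kernel:
  assumes n: "n \<in> carrier F" "\<pi> n = \<one>" and f: "f \<in> carrier F"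
  shows "\<exists>m \<in> prim_kernel B. n \<otimes>\<^bsub>F\<^esub> f = m \<otimes>\<^bsub>F\<^esub> (f \<otimes>\<^bsub>F\<^esub> n)"
proof (rule bexI)
  let ?m = "(n \<otimes>\<^bsub>F\<^esub> f) \<otimes>\<^bsub>F\<^esub> inv\<^bsub>F\<^esub> (f \<otimes>\<^bsub>F\<^esub> n)"
  have m: "?m \<in> carrier F" "\<pi> ?m = \<one>" using n f by auto
  show eq: "n \<otimes>\<^bsub>F\<^esub> f = ?m \<otimes>\<^bsub>F\<^esub> (f \<otimes>\<^bsub>F\<^esub> n)"
    using n f by (simp add: F.m_assoc F.inv_mult_group)
  have "prim (n \<otimes>\<^bsub>F\<^esub> f) - (prim ?m + prim (f \<otimes>\<^bsub>F\<^esub> n)) \<in> B"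
    using prim_kernel_mult[OF m, of "f \<otimes>\<^bsub>F\<^esub> n"] n f eq by simp
  from diff_mem[OF diff_mem[OF prim_kernel_mult[OF n f] prim_mult_kernel[OF n f]] this]
  show "?m \<in> prim_kernel B" using m by (simp add: prim_kernel_def algebra_simps)
qed

text \<open>\<open>prim\<close> descends along a set-theoretic section \<open>s\<close> of \<pi>:
  the product of \<open>s g\<close> and \<open>s h\<close> differs from
  \<open>s (g \<otimes> h)\<close> by a kernel element, whose \<open>prim\<close> lies in
  \<open>D\<close>.\<close>

lemma primitive_mod:
  assumes D: "diff_closed D" "B \<subseteq> D" and surj: "\<pi> ` carrier F = carrier G"
    and ker: "\<And>n. n \<in> carrier F \<Longrightarrow> \<pi> n = \<one> \<Longrightarrow> prim n \<in> D"
  obtains \<psi> where "\<And>g h. g \<in> carrier G \<Longrightarrow> h \<in> carrier G \<Longrightarrow>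
    e g h - (\<psi> h - \<psi> (g \<otimes> h) + \<psi> g) \<in> D"
proof -
  interpret D: diff_closed D by (rule D(1))
  define s where "s = inv_into (carrier F) \<pi>"
  have s: "s g \<in> carrier F" "\<pi> (s g) = g" if "g \<in> carrier G" for g
    using that surj by (auto simp: s_def inv_into_into f_inv_into_f)
  have "e g h - (prim (s h) - prim (s (g \<otimes> h)) + prim (s g)) \<in> D"
    if gh: "g \<in> carrier G" "h \<in> carrier G" for g h
  proof -
    define k where "k = s (g \<otimes> h)"
    have k: "k \<in> carrier F" "\<pi> k = g \<otimes> h" using s gh by (simp_all add: k_def)
    let ?n = "s g \<otimes>\<^bsub>F\<^esub> s h \<otimes>\<^bsub>F\<^esub> inv\<^bsub>F\<^esub> k"
    have n: "?n \<in> carrier F" "\<pi> ?n = \<one>" using s gh k by auto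
    have "?n \<otimes>\<^bsub>F\<^esub> k = s g \<otimes>\<^bsub>F\<^esub> s h" using s gh k by (simp add: F.m_assoc)
    then have 1: "prim (s g \<otimes>\<^bsub>F\<^esub> s h) - (prim ?n + prim k) \<in> D"
      using prim_kernel_mult[OF n k(1)] D(2) by auto
    have 2: "prim (s g \<otimes>\<^bsub>F\<^esub> s h) - (prim (s g) + prim (s h) - e g h) \<in> D"
      using prim_mult[of "s g" "s h"] s gh D(2) by auto
    from D.diff_mem[OF D.diff_mem[OF 2 1] ker[OF n]] show ?thesis
      by (simp add: algebra_simps flip: k_def)
  qed
  then show thesis by (rule that)
qed

end

lemma (in group_hom) hom_relator_value:
  "a \<in> carrier G \<Longrightarrow> b \<in> carrier G \<Longrightarrow> h (G.relator_value a b) = H.relator_value (h a) (h b)"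
  by (simp add: G.relator_value_def H.relator_value_def Let_def)

lemma (in group_hom) hom_torus_meridian:
  "a \<in> carrier G \<Longrightarrow> b \<in> carrier G \<Longrightarrow> h (G.torus_meridian a b) = H.torus_meridian (h a) (h b)"
  by (simp add: G.torus_meridian_def H.torus_meridian_def Let_def)

lemma (in group) relator_value_closed:
  "a \<in> carrier G \<Longrightarrow> b \<in> carrier G \<Longrightarrow> relator_value a b \<in> carrier G"
  by (simp add: relator_value_def Let_def)

lemma (in group) torus_meridian_closed:
  "a \<in> carrier G \<Longrightarrow> b \<in> carrier G \<Longrightarrow> torus_meridian a b \<in> carrier G"
  by (simp add: torus_meridian_def Let_def)

text \<open>\<open>torus_commutator\<close> is applied twice: in \<open>G\<close>, where the relator
  is trivial, and in the quotient by \<open>prim_kernel B\<close>, where it is central. The second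
  relation lifts to the free group up to some \<open>m\<close> with \<open>prim m\<close> in
  \<open>B\<close>; evaluating \<open>prim\<close> on it pairs \<open>e\<close> with the
  torus.\<close>

lemma (in free_cocycle) torus_cocycle:
  assumes ab: "a \<in> carrier F" "b \<in> carrier F" and r: "\<pi> (F.relator_value a b) = \<one>"
  defines "p \<equiv> \<pi> (a \<otimes>\<^bsub>F\<^esub> b)" and "g \<equiv> \<pi> (F.torus_meridian a b)"
  shows "p \<otimes> g = g \<otimes> p" "e p g - e g p - prim (F.relator_value a b) \<in> B"
proof -
  let ?r = "F.relator_value a b" and ?p = "a \<otimes>\<^bsub>F\<^esub> b" and ?g = "F.torus_meridian a b"
  have cl: "?r \<in> carrier F" "?p \<in> carrier F" "?g \<in> carrier F"
    using ab by (simp_all add: F.relator_value_closed F.torus_meridian_closed)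
  have \<pi>ab: "\<pi> a \<in> carrier G" "\<pi> b \<in> carrier G" using ab by auto
  have \<pi>r: "G.relator_value (\<pi> a) (\<pi> b) = \<one>" using r ab by (simp add: \<pi>.hom_relator_value)
  have "G.relator_value (\<pi> a) (\<pi> b) \<otimes> \<pi> a = \<pi> a \<otimes> G.relator_value (\<pi> a) (\<pi> b)"
    "G.relator_value (\<pi> a) (\<pi> b) \<otimes> \<pi> b = \<pi> b \<otimes> G.relator_value (\<pi> a) (\<pi> b)"
    unfolding \<pi>r using \<pi>ab by simp_all
  from G.torus_commutator[OF \<pi>ab this]
  have "g \<otimes> p = \<one> \<otimes> (p \<otimes> g)"
    unfolding \<pi>r p_def g_def \<pi>.hom_torus_meridian[OF ab] \<pi>.hom_mult[OF ab] .
  then show "p \<otimes> g = g \<otimes> p"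
    using cl by (simp add: p_def g_def del: \<pi>.hom_mult)
  let ?M = "prim_kernel B"
  interpret M: normal ?M F by (rule normal_prim_kernel) (unfold_locales, simp)
  define Q where "Q = F Mod ?M"
  define q where "q = (\<lambda>x. ?M #>\<^bsub>F\<^esub> x)"
  interpret Q: group Q unfolding Q_def by (rule M.factorgroup_is_group)
  interpret q: group_hom F Q q
    by unfold_locales (simp only: q_def Q_def M.r_coset_hom_Mod)
  have qM: "q m = \<one>\<^bsub>Q\<^esub>" if "m \<in> ?M" for m
    using F.coset_join2[OF M.mem_carrier[OF that] M.subgroup_axioms that]
    by (simp add: q_def Q_def FactGroup_def)
  have rf: "q ?r \<otimes>\<^bsub>Q\<^esub> q f = q f \<otimes>\<^bsub>Q\<^esub> q ?r" if f: "f \<in> carrier F" for f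
  proof -
    obtain m where m: "m \<in> ?M" "?r \<otimes>\<^bsub>F\<^esub> f = m \<otimes>\<^bsub>F\<^esub> (f \<otimes>\<^bsub>F\<^esub> ?r)"
      using commutator_mem_prim_kernel[OF cl(1) r f] by blast
    have "q (?r \<otimes>\<^bsub>F\<^esub> f) = q (f \<otimes>\<^bsub>F\<^esub> ?r)"
      unfolding m(2) using M.mem_carrier[OF m(1)] qM[OF m(1)] cl f by simp
    then show ?thesis using cl f by simp
  qed
  have qab: "q a \<in> carrier Q" "q b \<in> carrier Q" using q.hom_closed ab by blast+
  have qr: "q ?r = Q.relator_value (q a) (q b)" by (rule q.hom_relator_value[OF ab])
  have qg: "q ?g = Q.torus_meridian (q a) (q b)" by (rule q.hom_torus_meridian[OF ab])
  have qp: "q ?p = q a \<otimes>\<^bsub>Q\<^esub> q b" by (rule q.hom_mult[OF ab])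
  have "q (?g \<otimes>\<^bsub>F\<^esub> ?p) = q ?g \<otimes>\<^bsub>Q\<^esub> q ?p"
    by (rule q.hom_mult[OF cl(3,2)])
  also have "\<dots> = q ?r \<otimes>\<^bsub>Q\<^esub> (q ?p \<otimes>\<^bsub>Q\<^esub> q ?g)"
    unfolding qr qg qp
    by (rule Q.torus_commutator[OF qab rf[OF ab(1), unfolded qr] rf[OF ab(2), unfolded qr]])
  also have "q ?p \<otimes>\<^bsub>Q\<^esub> q ?g = q (?p \<otimes>\<^bsub>F\<^esub> ?g)"
    by (rule q.hom_mult[OF cl(2,3), symmetric])
  also have "q ?r \<otimes>\<^bsub>Q\<^esub> \<dots> = q (?r \<otimes>\<^bsub>F\<^esub> (?p \<otimes>\<^bsub>F\<^esub> ?g))"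
    by (rule q.hom_mult[OF cl(1) F.m_closed[OF cl(2,3)], symmetric])
  finally have eq: "?M #>\<^bsub>F\<^esub> (?g \<otimes>\<^bsub>F\<^esub> ?p) = ?M #>\<^bsub>F\<^esub> (?r \<otimes>\<^bsub>F\<^esub> (?p \<otimes>\<^bsub>F\<^esub> ?g))"
    unfolding q_def .
  have "?g \<otimes>\<^bsub>F\<^esub> ?p \<in> ?M #>\<^bsub>F\<^esub> (?r \<otimes>\<^bsub>F\<^esub> (?p \<otimes>\<^bsub>F\<^esub> ?g))"
    by (rule equalityD1[OF eq, THEN subsetD, OF F.rcos_self[OF F.m_closed[OF cl(3,2)] M.subgroup_axioms]])
  then obtain m where m: "m \<in> ?M" and gp: "?g \<otimes>\<^bsub>F\<^esub> ?p = m \<otimes>\<^bsub>F\<^esub> (?r \<otimes>\<^bsub>F\<^esub> (?p \<otimes>\<^bsub>F\<^esub> ?g))"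
    unfolding r_coset_def by blast
  have m': "m \<in> carrier F" "\<pi> m = \<one>" "prim m \<in> B"
    using m unfolding prim_kernel_def by blast+
  let ?h = "?p \<otimes>\<^bsub>F\<^esub> ?g"
  have h: "?h \<in> carrier F" by (rule F.m_closed[OF cl(2,3)])
  have 1: "prim (?g \<otimes>\<^bsub>F\<^esub> ?p) - (prim m + prim (?r \<otimes>\<^bsub>F\<^esub> ?h)) \<in> B"
    using prim_kernel_mult[OF m'(1,2) F.m_closed[OF cl(1) h]] by (subst gp)
  have 2: "prim (?r \<otimes>\<^bsub>F\<^esub> ?h) - (prim ?r + prim ?h) \<in> B"
    by (rule prim_kernel_mult[OF cl(1) r h])
  have 3: "prim (?g \<otimes>\<^bsub>F\<^esub> ?p) - (prim ?g + prim ?p - e g p) \<in> B"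
    unfolding p_def g_def by (rule prim_mult[OF cl(3,2)])
  have 4: "prim ?h - (prim ?p + prim ?g - e p g) \<in> B"
    unfolding p_def g_def by (rule prim_mult[OF cl(2,3)])
  \<comment> \<open>The goal written as a combination of the facts 1 to 4 and
    \<open>prim m \<in> B\<close>.\<close>
  have "x - y - r = (u - (m + v)) + m + (v - (r + h)) - (u - (g + p - y)) + (h - (p + g - x))"
    for x y r u v m h g p :: 'c
    by (simp add: algebra_simps)
  note eq = this[of "e p g" "e g p" "prim ?r" "prim (?g \<otimes>\<^bsub>F\<^esub> ?p)" "prim m" "prim (?r \<otimes>\<^bsub>F\<^esub> ?h)"
      "prim ?h" "prim ?g" "prim ?p"]
  show "e p g - e g p - prim ?r \<in> B"
    unfolding eq by (rule add_mem[OF diff_mem[OF add_mem[OF add_mem[OF 1 m'(3)] 2] 3] 4])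
qed

section \<open>The projection of the free group onto the one-relator group\<close>

abbreviation one_relator_proj :: "'s set \<Rightarrow> 's letter list \<Rightarrow> 's letter list \<Rightarrow> 's letter list set"
  where "one_relator_proj S w f \<equiv> normal_closure (free_group S) {w} #>\<^bsub>free_group S\<^esub> f"

lemma one_relator_proj:
  assumes "w \<in> carrier (free_group S)"
  shows "one_relator_proj S w \<in> hom (free_group S) (one_relator_group S w)"
    and "one_relator_proj S w ` carrier (free_group S) = carrier (one_relator_group S w)"
    and "f \<in> carrier (free_group S) \<Longrightarrow> one_relator_proj S w f = \<one>\<^bsub>one_relator_group S w\<^esub> \<longleftrightarrow>
      f \<in> normal_closure (free_group S) {w}"
proof -
  let ?N = "normal_closure (free_group S) {w}"
  interpret F: group "free_group S" by (rule group_free_group)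
  interpret N: normal ?N "free_group S" using assms by (intro F.normal_closure_normal) simp
  show "one_relator_proj S w \<in> hom (free_group S) (one_relator_group S w)"
    unfolding one_relator_group_def by (rule N.r_coset_hom_Mod)
  show "one_relator_proj S w ` carrier (free_group S) = carrier (one_relator_group S w)"
    by (auto simp: one_relator_group_def FactGroup_def RCOSETS_def)
  show "one_relator_proj S w f = \<one>\<^bsub>one_relator_group S w\<^esub> \<longleftrightarrow> f \<in> ?N"
    if "f \<in> carrier (free_group S)"
    using that F.coset_join1[OF _ _ N.subgroup_axioms] F.coset_join2[OF _ N.subgroup_axioms]
    by (auto simp: one_relator_group_def FactGroup_def)
qed

lemma mem_normal_closure: "w \<in> normal_closure G {w}"
  by (auto simp: normal_closure_def)

lemma normal_closure_minimal: "N \<lhd> G \<Longrightarrow> w \<in> N \<Longrightarrow> normal_closure G {w} \<subseteq> N"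
  by (auto simp: normal_closure_def)

section \<open>The bar complex\<close>

text \<open>A common finite index set makes additivity of the boundary a termwise
  computation.\<close>

lemma bar_boundary_superset:
  assumes "finite A" "Poly_Mapping.keys c \<subseteq> A" "n \<noteq> 0"
  shows "bar_boundary G n c = (\<Sum>xs\<in>A. \<Sum>i\<le>n.
    Poly_Mapping.single (bar_face G i xs) ((- 1) ^ i * Poly_Mapping.lookup c xs))"
  unfolding bar_boundary_def using assms
  by (auto intro!: sum.mono_neutral_left simp: in_keys_iff)

lemma bar_boundary_diff:
  "bar_boundary G n (c - d) = bar_boundary G n c - bar_boundary G n d"
proof (cases "n = 0")
  case False
  let ?A = "Poly_Mapping.keys c \<union> Poly_Mapping.keys d"
  have "Poly_Mapping.keys (c - d) \<subseteq> ?A" by (auto simp: in_keys_iff lookup_minus)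
  then show ?thesis
    using False
    by (simp add: bar_boundary_superset[of ?A] lookup_minus right_diff_distrib single_diff sum_subtractf)
qed (simp add: bar_boundary_def)

lemma bar_boundary_zero [simp]: "bar_boundary G n 0 = 0"
  using bar_boundary_diff[of G n 0 0] by simp

lemma bar_boundary_single:
  "n \<noteq> 0 \<Longrightarrow> bar_boundary G n (Poly_Mapping.single xs k) =
    (\<Sum>i\<le>n. Poly_Mapping.single (bar_face G i xs) ((- 1) ^ i * k))"
  by (subst bar_boundary_superset[of "{xs}"]) auto

lemma bar_boundary_single_2:
  "bar_boundary G 2 (Poly_Mapping.single [g, h] k) =
    Poly_Mapping.single [h] k - Poly_Mapping.single [g \<otimes>\<^bsub>G\<^esub> h] k + Poly_Mapping.single [g] k"
  by (simp add: bar_boundary_single bar_face_def numeral_2_eq_2 single_uminus)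

lemma bar_boundary_single_3:
  "bar_boundary G 3 (Poly_Mapping.single [g, h, l] k) =
    Poly_Mapping.single [h, l] k - Poly_Mapping.single [g \<otimes>\<^bsub>G\<^esub> h, l] k +
    Poly_Mapping.single [g, h \<otimes>\<^bsub>G\<^esub> l] k - Poly_Mapping.single [g, h] k"
  by (simp add: bar_boundary_single bar_face_def numeral_3_eq_3 single_uminus)

lemma bar_chains_diff: "c \<in> bar_chains G n \<Longrightarrow> d \<in> bar_chains G n \<Longrightarrow> c - d \<in> bar_chains G n"
  using keys_diff[of c d] by (auto simp: bar_chains_def)

lemma bar_chains_single:
  "length xs = n \<Longrightarrow> set xs \<subseteq> carrier G \<Longrightarrow> Poly_Mapping.single xs k \<in> bar_chains G n"
  by (simp add: bar_chains_def)

lemma zero_bar_chains [simp]: "0 \<in> bar_chains G n"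
  by (simp add: bar_chains_def)

lemma diff_closed_bar_boundaries: "diff_closed (bar_boundaries G n)"
proof
  show "0 \<in> bar_boundaries G n"
    unfolding bar_boundaries_def by (rule image_eqI[of _ _ 0]) simp_all
  show "x - y \<in> bar_boundaries G n" if "x \<in> bar_boundaries G n" "y \<in> bar_boundaries G n" for x y
    using that unfolding bar_boundaries_def
    by (auto simp flip: bar_boundary_diff intro!: imageI bar_chains_diff)
qed

text \<open>The boundary of one 3-simplex. Read differently, sending a pair to its bar symbol is a
  2-cocycle with values in chains modulo boundaries.\<close>

lemma bar_cocycle:
  assumes "g \<in> carrier G" "h \<in> carrier G" "l \<in> carrier G"
  shows "Poly_Mapping.single [h, l] k - Poly_Mapping.single [g \<otimes>\<^bsub>G\<^esub> h, l] k +
    Poly_Mapping.single [g, h \<otimes>\<^bsub>G\<^esub> l] k - Poly_Mapping.single [g, h] k \<in> bar_boundaries G 2"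
  unfolding bar_boundaries_def bar_boundary_single_3[symmetric]
  using assms bar_chains_single[of "[g, h, l]" 3 G k] by (simp add: numeral_3_eq_3 numeral_2_eq_2)

text \<open>For commuting \<open>p\<close> and \<open>g\<close>, this is \<open>k\<close> times the
  image of the fundamental cycle of a torus cut into two triangles.\<close>

definition torus :: "'g \<Rightarrow> 'g \<Rightarrow> 'k \<Rightarrow> ('g list \<Rightarrow>\<^sub>0 'k::comm_ring_1)"
  where "torus p g k = Poly_Mapping.single [p, g] k - Poly_Mapping.single [g, p] k"

lemma torus_add: "torus p g (k + l) = torus p g k + torus p g l"
  by (simp add: torus_def single_add)

text \<open>The class of the torus is additive in its first entry: the three 3-simplices on
  \<open>q\<close>, \<open>p\<close>, \<open>g\<close> in which \<open>q\<close> precedes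
  \<open>p\<close> bound the difference.\<close>

lemma torus_pow:
  fixes k :: "'k::comm_ring_1"
  assumes "group G" and pg: "p \<in> carrier G" "g \<in> carrier G" "p \<otimes>\<^bsub>G\<^esub> g = g \<otimes>\<^bsub>G\<^esub> p"
  shows "torus p g (of_nat (Suc n) * k) - torus (p [^]\<^bsub>G\<^esub> Suc n) g k \<in> bar_boundaries G 2"
proof -
  interpret group G by fact
  interpret diff_closed "bar_boundaries G 2 :: ('a list \<Rightarrow>\<^sub>0 'k) set" by (rule diff_closed_bar_boundaries)
  have comm: "p [^]\<^bsub>G\<^esub> m \<otimes>\<^bsub>G\<^esub> g = g \<otimes>\<^bsub>G\<^esub> p [^]\<^bsub>G\<^esub> m" for m :: nat
    using pg by (induction m) (simp_all add: m_assoc, simp flip: m_assoc)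
  show ?thesis
  proof (induction n)
    case 0
    then show ?case using pg by simp
  next
    case (Suc n)
    define q where "q = p [^]\<^bsub>G\<^esub> Suc n"
    have q: "q \<in> carrier G" "q \<otimes>\<^bsub>G\<^esub> g = g \<otimes>\<^bsub>G\<^esub> q" "p [^]\<^bsub>G\<^esub> Suc (Suc n) = q \<otimes>\<^bsub>G\<^esub> p"
      using pg comm[of "Suc n"] by (simp_all add: q_def)
    have gq: "g \<otimes>\<^bsub>G\<^esub> q \<in> carrier G" using q pg by simp
    have Suc_k: "of_nat (Suc (Suc n)) * k = of_nat (Suc n) * k + k"
      by (simp add: algebra_simps)
    note 1 = bar_cocycle[where k = k, OF q(1) pg(1,2)]
    note 2 = bar_cocycle[where k = k, OF pg(2) q(1) pg(1)]
    note 3 = bar_cocycle[where k = k, OF q(1) pg(2,1)]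
    have "torus p g (of_nat (Suc (Suc n)) * k) - torus (p [^]\<^bsub>G\<^esub> Suc (Suc n)) g k =
        (torus p g (of_nat (Suc n) * k) - torus q g k) + (torus p g k + torus q g k - torus (q \<otimes>\<^bsub>G\<^esub> p) g k)"
      unfolding q(3) Suc_k torus_add by (simp add: algebra_simps)
    also have "\<dots> \<in> bar_boundaries G 2"
    proof (rule add_mem[OF Suc[folded q_def]])
      show "torus p g k + torus q g k - torus (q \<otimes>\<^bsub>G\<^esub> p) g k \<in> bar_boundaries G 2"
        using diff_mem[OF add_mem[OF 1 2] 3] pg(3) q(2)
        by (simp add: torus_def algebra_simps)
    qed
    finally show ?case .
  qed
qed

text \<open>The bound is independent of \<open>p\<close>, so passing to powers of \<open>p\<close>
  gains a factor.\<close>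

lemma l1_norm_torus: "l1_norm (torus p g k) \<le> 2 * \<bar>k\<bar>"
proof -
  let ?t = "torus p g k"
  have "Poly_Mapping.keys ?t \<subseteq> {[p, g], [g, p]}"
    using keys_diff[of "Poly_Mapping.single [p, g] k" "Poly_Mapping.single [g, p] k"]
    by (auto simp: torus_def split: if_splits)
  then have "l1_norm ?t \<le> (\<Sum>x\<in>{[p, g], [g, p]}. \<bar>Poly_Mapping.lookup ?t x\<bar>)"
    unfolding l1_norm_def by (intro sum_mono2) auto
  also have "\<dots> \<le> \<bar>Poly_Mapping.lookup ?t [p, g]\<bar> + \<bar>Poly_Mapping.lookup ?t [g, p]\<bar>"
    by (cases "p = g") simp_all
  also have "\<dots> \<le> 2 * \<bar>k\<bar>"
    by (cases "p = g") (simp_all add: torus_def lookup_minus lookup_single)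
  finally show ?thesis .
qed


section \<open>The second homology of a one-relator group\<close>

lemma bar_cycle_comm_group:
  "comm_group (bar_cycle_group G n :: ('g list \<Rightarrow>\<^sub>0 'k::comm_ring_1) monoid)"
proof (rule comm_groupI)
  have neg: "- c \<in> carrier (bar_cycle_group G n)" if "c \<in> carrier (bar_cycle_group G n)"
    for c :: "'g list \<Rightarrow>\<^sub>0 'k"
    using that bar_chains_diff[of 0 G n c] bar_boundary_diff[of G n 0 c]
    by (simp add: bar_cycle_group_def)
  fix c d :: "'g list \<Rightarrow>\<^sub>0 'k"
  assume c: "c \<in> carrier (bar_cycle_group G n)"
  show "\<exists>y\<in>carrier (bar_cycle_group G n). y \<otimes>\<^bsub>bar_cycle_group G n\<^esub> c = \<one>\<^bsub>bar_cycle_group G n\<^esub>"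
    using neg[OF c] by (intro bexI[of _ "- c"]) (simp add: bar_cycle_group_def)
  assume "d \<in> carrier (bar_cycle_group G n)"
  from neg[OF this] show "c \<otimes>\<^bsub>bar_cycle_group G n\<^esub> d \<in> carrier (bar_cycle_group G n)"
    using c bar_chains_diff[of c G n "- d"] bar_boundary_diff[of G n c "- d"]
    by (simp add: bar_cycle_group_def)
qed (auto simp: bar_cycle_group_def algebra_simps)

lemma bar_boundary_boundary_3:
  fixes c :: "'g list \<Rightarrow>\<^sub>0 int"
  assumes "group G" "c \<in> bar_chains G 3"
  shows "bar_boundary G 3 c \<in> bar_chains G 2 \<and> bar_boundary G 2 (bar_boundary G 3 c) = 0"
proof -
  interpret group G by fact
  have "Poly_Mapping.keys c \<subseteq> {xs. length xs = 3 \<and> set xs \<subseteq> carrier G}"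
    using assms(2) by (auto simp: bar_chains_def)
  then show ?thesis
  proof (induction c rule: frag_induction)
    case (one xs)
    then obtain g h l where xs: "xs = [g, h, l]"
      by (auto simp: numeral_3_eq_3 length_Suc_conv)
    have add: "bar_boundary G 2 (x + y) = bar_boundary G 2 x + bar_boundary G 2 y" for x y :: "'g list \<Rightarrow>\<^sub>0 int"
      using bar_boundary_diff[of G 2 "x + y" y] by (simp add: algebra_simps)
    have addc: "x + y \<in> bar_chains G 2" if "x \<in> bar_chains G 2" "y \<in> bar_chains G 2" for x y :: "'g list \<Rightarrow>\<^sub>0 int"
      using bar_chains_diff[of x G 2 "0 - y"] bar_chains_diff[of 0 G 2 y] that by simp
    show ?case
      using one unfolding xs bar_boundary_single_3
      by (simp add: bar_boundary_diff add bar_boundary_single_2 m_assoc algebra_simps)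
        (intro bar_chains_diff addc bar_chains_single; simp)
  qed (auto simp: bar_boundary_diff intro: bar_chains_diff)
qed

lemma bar_boundaries_subgroup:
  assumes "group G"
  shows "subgroup (bar_boundaries G 2) (bar_cycle_group G 2 :: ('g list \<Rightarrow>\<^sub>0 int) monoid)"
proof -
  interpret C: comm_group "bar_cycle_group G 2 :: ('g list \<Rightarrow>\<^sub>0 int) monoid" by (rule bar_cycle_comm_group)
  interpret diff_closed "bar_boundaries G 2 :: ('g list \<Rightarrow>\<^sub>0 int) set" by (rule diff_closed_bar_boundaries)
  have sub: "bar_boundaries G 2 \<subseteq> carrier (bar_cycle_group G 2 :: ('g list \<Rightarrow>\<^sub>0 int) monoid)"
    using bar_boundary_boundary_3[OF assms]
    by (auto simp: bar_boundaries_def bar_cycle_group_def numeral_3_eq_3 numeral_2_eq_2)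
  show ?thesis
  proof (rule C.subgroupI)
    fix c :: "'g list \<Rightarrow>\<^sub>0 int" assume c: "c \<in> bar_boundaries G 2"
    have "inv\<^bsub>bar_cycle_group G 2\<^esub> c = - c"
      using c sub uminus_mem[OF c] by (intro C.inv_equality) (auto simp: bar_cycle_group_def)
    then show "inv\<^bsub>bar_cycle_group G 2\<^esub> c \<in> bar_boundaries G 2" using uminus_mem[OF c] by simp
  next
    show "c \<otimes>\<^bsub>bar_cycle_group G 2\<^esub> d \<in> bar_boundaries G 2"
      if "c \<in> bar_boundaries G 2" "d \<in> bar_boundaries G 2" for c d :: "'g list \<Rightarrow>\<^sub>0 int"
      using add_mem[OF that] by (simp add: bar_cycle_group_def)
  qed (use sub zero_mem in blast)+
qed

lemma bar_coset: "B #>\<^bsub>bar_cycle_group G n\<^esub> c = (\<lambda>b. b + c) ` B"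
  by (auto simp: r_coset_def bar_cycle_group_def)

lemma torus_cycle:
  assumes "p \<in> carrier G" "g \<in> carrier G" "p \<otimes>\<^bsub>G\<^esub> g = g \<otimes>\<^bsub>G\<^esub> p"
  shows "torus p g k \<in> carrier (bar_cycle_group G 2)"
  using assms
  by (auto simp: torus_def bar_cycle_group_def bar_boundary_diff bar_boundary_single_2
      intro!: bar_chains_diff bar_chains_single)

lemma map_real_torus: "Poly_Mapping.map real_of_int (torus p g k) = torus p g (real_of_int k)"
  by (rule poly_mapping_eqI)
    (simp add: torus_def Poly_Mapping.map.rep_eq lookup_minus lookup_single when_def)

section \<open>The torus class in the homology of the one-relator group and its norm\<close>

locale relator_group =
  fixes a b :: 's
  assumes a_neq_b: "a \<noteq> b"
begin

abbreviation F :: "'s letter list monoid" where "F \<equiv> free_group {a, b}"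
abbreviation G :: "'s letter list set monoid" where "G \<equiv> one_relator_group {a, b} (relator a b)"
abbreviation \<pi> :: "'s letter list \<Rightarrow> 's letter list set" where "\<pi> \<equiv> one_relator_proj {a, b} (relator a b)"

sublocale F: group F by (rule group_free_group)
sublocale G: group G by (rule group_one_relator_group[OF relator_closed[OF a_neq_b]])

definition "p = \<pi> ([pos a] \<otimes>\<^bsub>F\<^esub> [pos b])"
definition "g = \<pi> (F.torus_meridian [pos a] [pos b])"

lemma generators: "[pos a] \<in> carrier F" "[pos b] \<in> carrier F"
  by (simp_all add: free_group_def reduced_Cons)

lemma pg_closed: "p \<in> carrier G" "g \<in> carrier G"
proof -
  have "\<pi> f \<in> carrier G" if "f \<in> carrier F" for f
    using that one_relator_proj(2)[OF relator_closed[OF a_neq_b]] by blast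
  then show "p \<in> carrier G" "g \<in> carrier G"
    unfolding p_def g_def by (simp_all add: generators F.torus_meridian_closed)
qed

text \<open>The cocycle machinery is applied to bar symbols modulo boundaries. There the torus
  equals \<open>prim\<close> of the relator, so modulo its multiples \<open>prim\<close> vanishes on
  the normal closure and the cocycle is a coboundary; hence every cycle is a multiple of the
  torus.\<close>

lemma torus_homology:
  shows "p \<otimes>\<^bsub>G\<^esub> g = g \<otimes>\<^bsub>G\<^esub> p"
    and "c \<in> carrier (bar_cycle_group G 2 :: ('s letter list set list \<Rightarrow>\<^sub>0 int) monoid) \<Longrightarrow>
      \<exists>k. c - torus p g k \<in> bar_boundaries G 2"
proof -
  let ?B = "bar_boundaries G 2 :: ('s letter list set list \<Rightarrow>\<^sub>0 int) set"
  let ?o = "frag_of [\<one>\<^bsub>G\<^esub>, \<one>\<^bsub>G\<^esub>]"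
  \<comment> \<open>Subtracting \<open>?o\<close> normalizes the cocycle; it drops out of the
    torus.\<close>
  define e where "e = (\<lambda>x y. frag_of [x, y] - ?o)"
  note rel = relator_closed[OF a_neq_b]
  note proj = one_relator_proj[OF rel]
  interpret cocycle: free_cocycle ?B G "{a, b}" \<pi> e
  proof (intro free_cocycle.intro free_cocycle_axioms.intro diff_closed_bar_boundaries)
    show "group G" by (rule G.is_group)
    show "\<pi> \<in> hom F G" by (rule proj(1))
    show "e \<one>\<^bsub>G\<^esub> \<one>\<^bsub>G\<^esub> = 0" by (simp add: e_def)
    fix x y z assume "x \<in> carrier G" "y \<in> carrier G" "z \<in> carrier G"
    from bar_cocycle[where k = "1 :: int", OF this]
    show "e y z - e (x \<otimes>\<^bsub>G\<^esub> y) z + e x (y \<otimes>\<^bsub>G\<^esub> z) - e x y \<in> ?B"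
      by (simp add: e_def algebra_simps)
  qed
  have r: "F.relator_value [pos a] [pos b] = relator a b" by (rule relator_eq[OF a_neq_b, symmetric])
  have \<pi>r: "\<pi> (relator a b) = \<one>\<^bsub>G\<^esub>" using proj(3)[OF rel] by (simp add: mem_normal_closure)
  note torus = cocycle.torus_cocycle[OF generators, unfolded r, OF \<pi>r, folded p_def g_def]
  show "p \<otimes>\<^bsub>G\<^esub> g = g \<otimes>\<^bsub>G\<^esub> p" by (rule torus(1))
  have T: "torus p g 1 - cocycle.prim (relator a b) \<in> ?B"
    using torus(2) by (simp add: e_def torus_def)
  define D where "D = {d. \<exists>k. d - torus p g k \<in> ?B}"
  have D: "diff_closed D"
  proof
    have "torus p g 0 = (0 :: 's letter list set list \<Rightarrow>\<^sub>0 int)" by (simp add: torus_def)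
    then show "0 \<in> D" unfolding D_def by (intro CollectI exI[of _ 0]) simp
    fix x y assume "x \<in> D" "y \<in> D"
    then obtain k l where "x - torus p g k \<in> ?B" "y - torus p g l \<in> ?B" by (auto simp: D_def)
    from cocycle.diff_mem[OF this] have "(x - y) - torus p g (k - l) \<in> ?B"
      using torus_add[of p g "k - l" l] by (simp add: algebra_simps)
    then show "x - y \<in> D" by (auto simp: D_def)
  qed
  have BD: "?B \<subseteq> D"
  proof
    fix x assume "x \<in> ?B"
    then have "x - torus p g 0 \<in> ?B" by (simp add: torus_def)
    then show "x \<in> D" unfolding D_def by blast
  qed
  have "cocycle.prim (relator a b) \<in> D"
    using cocycle.uminus_mem[OF T] unfolding D_def by (intro CollectI exI[of _ 1]) simp
  then have "relator a b \<in> cocycle.prim_kernel D" using rel \<pi>r by (simp add: cocycle.prim_kernel_def)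
  then have "normal_closure F {relator a b} \<subseteq> cocycle.prim_kernel D"
    by (rule normal_closure_minimal[OF cocycle.normal_prim_kernel[OF D BD]])
  then have ker: "cocycle.prim n \<in> D" if "n \<in> carrier F" "\<pi> n = \<one>\<^bsub>G\<^esub>" for n
    using proj(3)[OF that(1)] that(2) by (auto simp: cocycle.prim_kernel_def)
  obtain \<psi> where \<psi>: "\<And>x y. x \<in> carrier G \<Longrightarrow> y \<in> carrier G \<Longrightarrow>
      e x y - (\<psi> y - \<psi> (x \<otimes>\<^bsub>G\<^esub> y) + \<psi> x) \<in> D"
    using cocycle.primitive_mod[OF D BD proj(2) ker] by blast
  \<comment> \<open>The summand \<open>?o\<close> undoes the normalization: the boundary of a bar
    symbol has coefficient sum 1, so \<open>?o\<close> is restored exactly once.\<close>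
  define \<Phi> where "\<Phi> = frag_extend (\<lambda>xs. \<psi> (hd xs) + ?o)"
  have \<Phi>: "c - \<Phi> (bar_boundary G 2 c) \<in> D" if "c \<in> bar_chains G 2" for c
  proof -
    have "Poly_Mapping.keys c \<subseteq> {xs. length xs = 2 \<and> set xs \<subseteq> carrier G}"
      using that by (auto simp: bar_chains_def)
    then show ?thesis
    proof (induction c rule: frag_induction)
      case zero
      then show ?case using D by (simp add: \<Phi>_def diff_closed.zero_mem)
    next
      case (one xs)
      then obtain x y where xs: "xs = [x, y]" "x \<in> carrier G" "y \<in> carrier G"
        by (auto simp: numeral_2_eq_2 length_Suc_conv)
      have "frag_of xs - \<Phi> (bar_boundary G 2 (frag_of xs)) = e x y - (\<psi> y - \<psi> (x \<otimes>\<^bsub>G\<^esub> y) + \<psi> x)"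
        unfolding xs(1) bar_boundary_single_2
        by (simp add: \<Phi>_def e_def frag_extend_add frag_extend_diff algebra_simps)
      then show ?case using \<psi>[OF xs(2,3)] by simp
    next
      case (diff c d)
      from diff_closed.diff_mem[OF D this] show ?case
        by (simp add: bar_boundary_diff \<Phi>_def frag_extend_diff algebra_simps)
    qed
  qed
  \<comment> \<open>On a cycle the argument of \<Phi> is 0, so \<open>c\<close> itself lies in
    \<open>D\<close>.\<close>
  show "\<exists>k. c - torus p g k \<in> ?B" if "c \<in> carrier (bar_cycle_group G 2)"
    using \<Phi>[of c] that by (auto simp: bar_cycle_group_def \<Phi>_def D_def)
qed

lemma torus_mem_homology_class:
  fixes z :: "('s letter list set list \<Rightarrow>\<^sub>0 int) set"
  assumes "z \<in> carrier (bar_homology G 2)"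
  shows "\<exists>k. torus p g k \<in> z \<and> z = bar_boundaries G 2 #>\<^bsub>bar_cycle_group G 2\<^esub> torus p g k"
proof -
  let ?C = "bar_cycle_group G 2 :: ('s letter list set list \<Rightarrow>\<^sub>0 int) monoid"
  let ?B = "bar_boundaries G 2 :: ('s letter list set list \<Rightarrow>\<^sub>0 int) set"
  interpret C: comm_group ?C by (rule bar_cycle_comm_group)
  interpret diff_closed ?B by (rule diff_closed_bar_boundaries)
  obtain c where c: "c \<in> carrier ?C" "z = ?B #>\<^bsub>?C\<^esub> c"
    using assms by (auto simp: bar_homology_def FactGroup_def RCOSETS_def)
  obtain k where "c - torus p g k \<in> ?B" using torus_homology(2)[OF c(1)] by blast
  from uminus_mem[OF this] have mem: "torus p g k \<in> z"
    unfolding c(2) bar_coset by (intro image_eqI[of _ _ "torus p g k - c"]) simp_all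
  then show ?thesis
    using C.repr_independence[OF _ c(1) bar_boundaries_subgroup[OF G.is_group]] unfolding c(2) by blast
qed

text \<open>The torus class generates, which gives the choice in \<open>simplicial_volume\<close> a
  witness.\<close>

lemma fundamental_class_exists: "\<exists>\<alpha>. fundamental_class {a, b} (relator a b) \<alpha>"
proof -
  let ?C = "bar_cycle_group G 2 :: ('s letter list set list \<Rightarrow>\<^sub>0 int) monoid"
  let ?B = "bar_boundaries G 2 :: ('s letter list set list \<Rightarrow>\<^sub>0 int) set"
  let ?H = "bar_homology G 2 :: ('s letter list set list \<Rightarrow>\<^sub>0 int) set monoid"
  interpret C: comm_group ?C by (rule bar_cycle_comm_group)
  interpret B: normal ?B ?C
    by (rule C.subgroup_imp_normal[OF bar_boundaries_subgroup[OF G.is_group]])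
  interpret H: group ?H unfolding bar_homology_def by (rule B.factorgroup_is_group)
  define q where "q = (\<lambda>c. ?B #>\<^bsub>?C\<^esub> c)"
  interpret q: group_hom ?C ?H q
    by unfold_locales (simp only: q_def bar_homology_def B.r_coset_hom_Mod)
  define z where "z = q (torus p g 1)"
  have cyc: "torus p g k \<in> carrier ?C" for k
    by (rule torus_cycle[OF pg_closed torus_homology(1)])
  have z: "z \<in> carrier ?H" unfolding z_def by (rule q.hom_closed[OF cyc])
  have step: "q (torus p g (k + 1)) = q (torus p g k) \<otimes>\<^bsub>?H\<^esub> z" for k
    unfolding torus_add z_def q.hom_mult[OF cyc cyc, symmetric] by (simp add: bar_cycle_group_def)
  have gen: "q (torus p g k) \<in> generate ?H {z}" for k
  proof (induction k rule: int_induct[where k = 0])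
    case base
    have "torus p g 0 = \<one>\<^bsub>?C\<^esub>" by (simp add: torus_def bar_cycle_group_def)
    then show ?case using q.hom_one by (simp add: generate.one)
  next
    case (step1 k)
    then show ?case unfolding step by (blast intro: generate.eng generate.incl)
  next
    case (step2 k)
    have "q (torus p g (k - 1)) = q (torus p g k) \<otimes>\<^bsub>?H\<^esub> inv\<^bsub>?H\<^esub> z"
      by (rule iffD2[OF H.inv_solve_right[OF q.hom_closed[OF cyc] q.hom_closed[OF cyc] z]])
        (use step[of "k - 1"] in simp)
    then show ?case using step2 by (simp add: generate.eng generate.inv)
  qed
  have "generate ?H {z} = carrier ?H"
  proof
    show "generate ?H {z} \<subseteq> carrier ?H" using H.generate_incl[of "{z}"] z by simp
    show "carrier ?H \<subseteq> generate ?H {z}"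
      using torus_mem_homology_class gen unfolding q_def by blast
  qed
  then show ?thesis unfolding fundamental_class_def Let_def using z by blast
qed

text \<open>Every integral class contains a multiple of the torus, so the bound holds whichever
  generator is chosen.\<close>

lemma l1_seminorm_fundamental_class:
  assumes "fundamental_class {a, b} (relator a b) \<alpha>"
  shows "l1_seminorm \<alpha> < 2"
proof -
  let ?C = "bar_cycle_group G 2 :: ('s letter list set list \<Rightarrow>\<^sub>0 real) monoid"
  let ?B = "bar_boundaries G 2 :: ('s letter list set list \<Rightarrow>\<^sub>0 real) set"
  interpret diff_closed ?B by (rule diff_closed_bar_boundaries)
  obtain z :: "('s letter list set list \<Rightarrow>\<^sub>0 int) set"
    where z: "z \<in> carrier (bar_homology G 2)" "\<alpha> = real_class G 2 z"
    using assms unfolding fundamental_class_def Let_def by blast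
  obtain k where k: "torus p g k \<in> z" using torus_mem_homology_class[OF z(1)] by blast
  \<comment> \<open>With \<open>Suc n\<close> larger than the absolute value of \<open>k\<close>,
    the torus on the power \<open>Suc n\<close> of \<open>p\<close> has a coefficient below 1 in
    absolute value.\<close>
  define n where "n = nat \<bar>k\<bar>"
  define d where "d = torus (p [^]\<^bsub>G\<^esub> Suc n) g (real_of_int k / real (Suc n))"
  have "torus p g (real_of_int k) - d \<in> ?B"
    using torus_pow[OF G.is_group pg_closed torus_homology(1), of n "real_of_int k / real (Suc n)"]
    by (simp add: d_def)
  from uminus_mem[OF this] have "d \<in> ?B #>\<^bsub>?C\<^esub> torus p g (real_of_int k)"
    unfolding bar_coset by (intro image_eqI[of _ _ "d - torus p g (real_of_int k)"]) simp_all
  then have "d \<in> \<alpha>"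
    unfolding z(2) real_class_def using k by (auto simp: map_real_torus intro!: bexI[of _ "torus p g k"])
  then have "l1_seminorm \<alpha> \<le> l1_norm d"
    unfolding l1_seminorm_def
    by (intro cINF_lower bdd_belowI[of _ 0]) (auto simp: l1_norm_def intro: sum_nonneg)
  also have "\<dots> \<le> 2 * \<bar>real_of_int k / real (Suc n)\<bar>"
    unfolding d_def by (rule l1_norm_torus)
  also have "\<dots> < 2" by (simp add: n_def field_simps)
  finally show ?thesis .
qed

lemma simplicial_volume_relator: "simplicial_volume {a, b} (relator a b) < 2"
  unfolding simplicial_volume_def
  using fundamental_class_exists l1_seminorm_fundamental_class by (metis someI_ex)

end

theorem corollary1:
  fixes a b :: 's and S :: "'s set" and r :: "'s letter list"
  assumes "a \<noteq> b" and "S = {a, b}"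
    and "r = [pos a, pos a, pos b, neg a, neg b, pos a, pos b, neg a, neg b, neg b,
              neg a, pos b, pos a, pos a, pos b, neg a, neg b, neg b, neg a, pos b]"
  shows "r \<in> derived (free_group S) (carrier (free_group S)) - {\<one>\<^bsub>free_group S\<^esub>} \<and>
    simplicial_volume S r < 2 \<and>
    2 = 4 * (scl (free_group S) r - 1 / 2) \<and>
    \<not> (\<forall>w \<in> derived (free_group S) (carrier (free_group S)) - {\<one>\<^bsub>free_group S\<^esub>}.
            simplicial_volume S w = 4 * (scl (free_group S) w - 1 / 2))"
proof -
  interpret relator_group a b by unfold_locales (rule assms(1))
  have r: "r = relator a b" by (simp add: assms(3) relator_def)
  have mem: "r \<in> derived (free_group S) (carrier (free_group S)) - {\<one>\<^bsub>free_group S\<^esub>}"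
    unfolding r assms(2) using relator_derived[OF assms(1)]
    by (simp add: relator_def free_group_def[of "{a, b}"])
  have vol: "simplicial_volume S r < 2"
    unfolding r assms(2) by (rule simplicial_volume_relator)
  have scl: "scl (free_group S) r = 1"
    unfolding r assms(2) by (rule scl_relator[OF assms(1)])
  show ?thesis
    using mem vol scl by (intro conjI notI) (auto dest: bspec[OF _ mem])
qed

end
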